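(* Let $d \ge 1$ and let $T = (T_1,\ldots,T_d)$ be a $d$-variable weighted shift such that each $T_j$ is a contraction (i.e. $\|T_j\| \le 1$ for $j=1,\ldots,d$). Then $T$ dilates to a $d$-tuple of commuting unitaries. In particular, $T$ satisfies von Neumann's inequality, that is, $$\|p(T)\| \le \sup\{|p(z)| : z \in \overline{\mathbb{D}}^d\}$$ for all $p \in \mathbb{C}[z_1,\ldots,z_d]$.
   Context: $\mathbb{N} = \{0,1,2,\ldots\}$, $\mathbb{D}$ is the open unit disc in $\mathbb{C}$, and $\varepsilon_j \in \mathbb{N}^d$ is the multi-index whose $j$-th coordinate is $1$ and whose other coordinates are $0$. $d$-variable weighted shift: let $\mathcal{H}$ be a complex Hilbert space with an orthonormal basis $\{e_I : I \in \mathbb{N}^d\}$ and let $(w_{I,j})_{(I,j) \in \mathbb{N}^d \times \{1,\ldots,d\}}$ be a bounded collection of strictly positive real numbers satisfying the commutation relations $w_{I,j}\, w_{I+\varepsilon_j,k} = w_{I,k}\, w_{I+\varepsilon_k,j}$ for all $I \in \mathbb{N}^d$ and $j,k \in \{1,\ldots,d\}$. The $d$-variable weighted shift with these weights is the unique $d$-tuple $(T_1,\ldots,T_d)$ of bounded operators on $\mathcal{H}$ with $T_j e_I = w_{I,j} e_{I+\varepsilon_j}$ for all $I$ and $j$. (The operators $T_j$ then commute.) Dilation: a $d$-tuple $(T_1,\ldots,T_d)$ of commuting operators on $\mathcal{H}$ dilates to a $d$-tuple of commuting unitaries if there are a Hilbert space $\mathcal{K}$ containing $\mathcal{H}$ as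 a closed subspace and commuting unitary operators $U_1,\ldots,U_d$ on $\mathcal{K}$ such that $p(T_1,\ldots,T_d) = P_{\mathcal{H}}\, p(U_1,\ldots,U_d)|_{\mathcal{H}}$ for all $p \in \mathbb{C}[z_1,\ldots,z_d]$, where $P_{\mathcal{H}}$ is the orthogonal projection of $\mathcal{K}$ onto $\mathcal{H}$. *)

theory Defs
  imports "HOL-Analysis.Analysis" "HOL-Library.Poly_Mapping"
begin

text \<open>
  A complex inner product is added on top of the class \<open>real_inner\<close>, which supplies the norm,
  the metric and the topology.  It is linear in the first argument, and its real part is the
  real inner product, so \<open>norm x = sqrt (Re (cinner x x))\<close>; positive definiteness is
  inherited from \<open>real_inner\<close>.
\<close>

class complex_inner = real_inner +
  fixes scaleC :: "complex \<Rightarrow> 'a \<Rightarrow> 'a" (infixr \<open>*\<^sub>C\<close> 75)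
    and cinner :: "'a \<Rightarrow> 'a \<Rightarrow> complex"
  assumes scaleC_add_right: "a *\<^sub>C (x + y) = a *\<^sub>C x + a *\<^sub>C y"
    and scaleC_add_left: "(a + b) *\<^sub>C x = a *\<^sub>C x + b *\<^sub>C x"
    and scaleC_scaleC: "a *\<^sub>C b *\<^sub>C x = (a * b) *\<^sub>C x"
    and scaleR_scaleC: "scaleR r x = complex_of_real r *\<^sub>C x"
    and cinner_commute: "cinner x y = cnj (cinner y x)"
    and cinner_add_left: "cinner (x + y) z = cinner x z + cinner y z"
    and cinner_scaleC_left: "cinner (a *\<^sub>C x) y = a * cinner x y"
    and inner_eq_Re_cinner: "inner x y = Re (cinner x y)"

class chilbert_space = complex_inner + complete_space

global_interpretation complex_vector: vector_space "scaleC :: complex \<Rightarrow> 'a \<Rightarrow> 'a::complex_inner"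
  defines cspan = complex_vector.span
proof
  show "1 *\<^sub>C x = x" for x :: 'a
    using scaleR_scaleC[of 1 x] by simp
qed (simp_all add: scaleC_add_right scaleC_add_left scaleC_scaleC)

abbreviation clinear :: "('a::complex_inner \<Rightarrow> 'b::complex_inner) \<Rightarrow> bool" where
  "clinear \<equiv> Vector_Spaces.linear scaleC scaleC"

definition bounded_operator :: "('a::complex_inner \<Rightarrow> 'b::complex_inner) \<Rightarrow> bool" where
  "bounded_operator f \<longleftrightarrow> clinear f \<and> bounded_linear f"

definition isometric :: "('a::complex_inner \<Rightarrow> 'b::complex_inner) \<Rightarrow> bool" where
  "isometric V \<longleftrightarrow> clinear V \<and> (\<forall>x y. cinner (V x) (V y) = cinner x y)"

definition unitary :: "('a::complex_inner \<Rightarrow> 'b::complex_inner) \<Rightarrow> bool" where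
  "unitary U \<longleftrightarrow> isometric U \<and> surj U"

definition orthogonal_projection :: "'a::complex_inner set \<Rightarrow> 'a \<Rightarrow> 'a" where
  "orthogonal_projection M x = (THE y. y \<in> M \<and> (\<forall>m\<in>M. cinner (x - y) m = 0))"

definition orthonormal_basis :: "('i \<Rightarrow> 'a::complex_inner) \<Rightarrow> bool" where
  "orthonormal_basis e \<longleftrightarrow>
     (\<forall>i j. cinner (e i) (e j) = (if i = j then 1 else 0)) \<and>
     closure (cspan (range e)) = UNIV"

typedef 'i ell2 = "{f :: 'i \<Rightarrow> complex. (\<lambda>i. (cmod (f i))\<^sup>2) summable_on UNIV}"
  morphisms ell2_nth Abs_ell2
  by (rule exI[of _ "\<lambda>_. 0"]) simp

setup_lifting type_definition_ell2

lemma square_summable_add: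
  assumes "(\<lambda>i. (cmod (f i))\<^sup>2) summable_on A" "(\<lambda>i. (cmod (g i))\<^sup>2) summable_on A"
  shows "(\<lambda>i. (cmod (f i + g i))\<^sup>2) summable_on A"
proof (rule summable_on_comparison_test)
  show "(\<lambda>i. 2 * (cmod (f i))\<^sup>2 + 2 * (cmod (g i))\<^sup>2) summable_on A"
    using assms by (intro summable_on_add summable_on_cmult_right)
  fix i
  have "(cmod (f i + g i))\<^sup>2 \<le> (cmod (f i) + cmod (g i))\<^sup>2"
    by (intro power_mono norm_triangle_ineq) auto
  also have "\<dots> \<le> 2 * (cmod (f i))\<^sup>2 + 2 * (cmod (g i))\<^sup>2"
    using sum_squares_bound[of "cmod (f i)" "cmod (g i)"] by (simp add: power2_sum)
  finally show "(cmod (f i + g i))\<^sup>2 \<le> 2 * (cmod (f i))\<^sup>2 + 2 * (cmod (g i))\<^sup>2" .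
qed auto

lemma square_summable_diff:
  assumes "(\<lambda>i. (cmod (f i))\<^sup>2) summable_on A" "(\<lambda>i. (cmod (g i))\<^sup>2) summable_on A"
  shows "(\<lambda>i. (cmod (f i - g i))\<^sup>2) summable_on A"
  using square_summable_add[of f A "\<lambda>i. - g i"] assms by simp

lemma square_summable_mult:
  assumes "(\<lambda>i. (cmod (f i))\<^sup>2) summable_on A" "(\<lambda>i. (cmod (g i))\<^sup>2) summable_on A"
  shows "(\<lambda>i. f i * cnj (g i)) summable_on A"
proof (rule abs_summable_summable, rule summable_on_comparison_test)
  show "(\<lambda>i. (cmod (f i))\<^sup>2 + (cmod (g i))\<^sup>2) summable_on A"
    using assms by (intro summable_on_add)
  fix i
  show "norm (f i * cnj (g i)) \<le> (cmod (f i))\<^sup>2 + (cmod (g i))\<^sup>2"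
    using sum_squares_bound[of "cmod (f i)" "cmod (g i)"]
      mult_nonneg_nonneg[OF norm_ge_zero[of "f i"] norm_ge_zero[of "g i"]]
    unfolding norm_mult complex_mod_cnj by linarith
qed auto

lemma ell2_summable: "(\<lambda>i. (cmod (ell2_nth x i))\<^sup>2) summable_on A"
proof -
  have "(\<lambda>i. (cmod (ell2_nth x i))\<^sup>2) summable_on UNIV"
    using ell2_nth[of x] by simp
  then show ?thesis
    by (rule summable_on_subset_banach) simp
qed

lemma ell2_mult_summable: "(\<lambda>i. ell2_nth x i * cnj (ell2_nth y i)) summable_on A"
  by (intro square_summable_mult ell2_summable)

instantiation ell2 :: (type) complex_inner
begin

lift_definition zero_ell2 :: "'a ell2" is "\<lambda>_. 0" by simp

lift_definition plus_ell2 :: "'a ell2 \<Rightarrow> 'a ell2 \<Rightarrow> 'a ell2" is "\<lambda>f g i. f i + g i"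
  by (rule square_summable_add)

lift_definition uminus_ell2 :: "'a ell2 \<Rightarrow> 'a ell2" is "\<lambda>f i. - f i" by simp

lift_definition minus_ell2 :: "'a ell2 \<Rightarrow> 'a ell2 \<Rightarrow> 'a ell2" is "\<lambda>f g i. f i - g i"
  by (rule square_summable_diff)

lift_definition scaleC_ell2 :: "complex \<Rightarrow> 'a ell2 \<Rightarrow> 'a ell2" is "\<lambda>c f i. c * f i"
  by (simp add: norm_mult power_mult_distrib summable_on_cmult_right)

definition scaleR_ell2 :: "real \<Rightarrow> 'a ell2 \<Rightarrow> 'a ell2" where
  "scaleR_ell2 r x = complex_of_real r *\<^sub>C x"

definition cinner_ell2 :: "'a ell2 \<Rightarrow> 'a ell2 \<Rightarrow> complex" where
  "cinner_ell2 x y = (\<Sum>\<^sub>\<infinity>i. ell2_nth x i * cnj (ell2_nth y i))"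

definition inner_ell2 :: "'a ell2 \<Rightarrow> 'a ell2 \<Rightarrow> real" where
  "inner_ell2 x y = Re (cinner x y)"

definition norm_ell2 :: "'a ell2 \<Rightarrow> real" where
  "norm_ell2 x = sqrt (inner x x)"

definition sgn_ell2 :: "'a ell2 \<Rightarrow> 'a ell2" where
  "sgn_ell2 x = scaleR (inverse (norm x)) x"

definition dist_ell2 :: "'a ell2 \<Rightarrow> 'a ell2 \<Rightarrow> real" where
  "dist_ell2 x y = norm (x - y)"

definition uniformity_ell2 :: "('a ell2 \<times> 'a ell2) filter" where
  "uniformity_ell2 = (INF e\<in>{0<..}. principal {(x, y). dist x y < e})"

definition open_ell2 :: "'a ell2 set \<Rightarrow> bool" where
  "open_ell2 U \<longleftrightarrow> (\<forall>x\<in>U. eventually (\<lambda>(x', y). x' = x \<longrightarrow> y \<in> U) uniformity)"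

lemma ell2_inner_self: "inner x x = (\<Sum>\<^sub>\<infinity>i. (cmod (ell2_nth x i))\<^sup>2)"
proof -
  have "(\<lambda>i. ell2_nth x i * cnj (ell2_nth x i)) = (\<lambda>i. complex_of_real ((cmod (ell2_nth x i))\<^sup>2))"
    by (rule ext) (rule complex_norm_square[symmetric])
  moreover have "infsum (\<lambda>i. complex_of_real ((cmod (ell2_nth x i))\<^sup>2)) UNIV
      = complex_of_real (\<Sum>\<^sub>\<infinity>i. (cmod (ell2_nth x i))\<^sup>2)"
    by (intro infsumI has_sum_of_real has_sum_infsum ell2_summable)
  ultimately show ?thesis
    by (simp add: inner_ell2_def cinner_ell2_def)
qed

instance
proof
  fix x y z :: "'a ell2" and a b :: complex and r s :: real
  show "x + y + z = x + (y + z)" by transfer (simp add: add.assoc)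
  show "x + y = y + x" by transfer (simp add: add.commute)
  show "0 + x = x" by transfer simp
  show "- x + x = 0" by transfer simp
  show "x - y = x + - y" by transfer simp
  show addr: "a *\<^sub>C (x + y) = a *\<^sub>C x + a *\<^sub>C y" for a by transfer (simp add: algebra_simps)
  show addl: "(a + b) *\<^sub>C x = a *\<^sub>C x + b *\<^sub>C x" for a b by transfer (simp add: algebra_simps)
  show mul: "a *\<^sub>C b *\<^sub>C x = (a * b) *\<^sub>C x" for a b by transfer (simp add: algebra_simps)
  have one: "1 *\<^sub>C x = x" by transfer simp
  show "scaleR r (x + y) = scaleR r x + scaleR r y" by (simp add: scaleR_ell2_def addr)
  show "scaleR (r + s) x = scaleR r x + scaleR s x" by (simp add: scaleR_ell2_def addl)
  show "scaleR r (scaleR s x) = scaleR (r * s) x" by (simp add: scaleR_ell2_def mul)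
  show "scaleR 1 x = x" by (simp add: scaleR_ell2_def one)
  show "scaleR r x = complex_of_real r *\<^sub>C x" by (rule scaleR_ell2_def)
  show "sgn x = scaleR (inverse (norm x)) x" by (rule sgn_ell2_def)
  show "dist x y = norm (x - y)" by (rule dist_ell2_def)
  show "uniformity = (INF e\<in>{0<..}. principal {(x :: 'a ell2, y). dist x y < e})"
    by (rule uniformity_ell2_def)
  show "open U \<longleftrightarrow> (\<forall>x\<in>U. \<forall>\<^sub>F (x', y) in uniformity. x' = x \<longrightarrow> y \<in> U)" for U :: "'a ell2 set"
    by (rule open_ell2_def)
  show commute: "cinner x y = cnj (cinner y x)"
    by (simp add: cinner_ell2_def mult.commute flip: infsum_cnj)
  show add: "cinner (x + y) z = cinner x z + cinner y z"
    by (simp add: cinner_ell2_def plus_ell2.rep_eq distrib_right infsum_add ell2_mult_summable)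
  show scale: "cinner (a *\<^sub>C x) y = a * cinner x y" for a
    by (simp add: cinner_ell2_def scaleC_ell2.rep_eq mult.assoc infsum_cmult_right')
  show "inner x y = Re (cinner x y)" by (rule inner_ell2_def)
  show "inner x y = inner y x" by (simp add: inner_ell2_def commute)
  show "inner (x + y) z = inner x z + inner y z" by (simp add: inner_ell2_def add)
  show "inner (scaleR r x) y = r * inner x y" by (simp add: inner_ell2_def scaleR_ell2_def scale)
  show "0 \<le> inner x x" by (simp add: ell2_inner_self infsum_nonneg)
  show "norm x = sqrt (inner x x)" by (rule norm_ell2_def)
  show "inner x x = 0 \<longleftrightarrow> x = 0"
  proof
    assume "inner x x = 0"
    then have "(cmod (ell2_nth x i))\<^sup>2 = 0" for i
      using nonneg_infsum_le_0D[of "\<lambda>i. (cmod (ell2_nth x i))\<^sup>2" UNIV i] ell2_summable[of x UNIV]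
      by (simp add: ell2_inner_self)
    then show "x = 0" by transfer auto
  next
    assume "x = 0"
    then show "inner x x = 0" by (simp add: ell2_inner_self zero_ell2.rep_eq)
  qed
qed

end

lemma ell2_finite_sum_le: "finite F \<Longrightarrow> (\<Sum>i\<in>F. (cmod (ell2_nth x i))\<^sup>2) \<le> (norm x)\<^sup>2"
  unfolding power2_norm_eq_inner[of x] ell2_inner_self
  by (intro finite_sum_le_infsum ell2_summable) auto

lemma ell2_nth_le_norm: "cmod (ell2_nth x i) \<le> norm x"
  by (rule power2_le_imp_le) (use ell2_finite_sum_le[of "{i}" x] in simp_all)

lemma ell2_norm_leI:
  assumes "\<And>F. finite F \<Longrightarrow> (\<Sum>i\<in>F. (cmod (ell2_nth x i))\<^sup>2) \<le> B\<^sup>2" and "0 \<le> B"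
  shows "norm x \<le> B"
proof -
  have "(\<Sum>\<^sub>\<infinity>i. (cmod (ell2_nth x i))\<^sup>2) \<le> B\<^sup>2"
    by (rule infsum_le_finite_sums) (auto intro: ell2_summable assms(1))
  then show ?thesis
    using assms(2) unfolding norm_eq_sqrt_inner[of x] ell2_inner_self
    by (intro real_le_lsqrt) auto
qed

instance ell2 :: (type) chilbert_space
proof
  fix X :: "nat \<Rightarrow> 'a ell2"
  assume X: "Cauchy X"
  have "Cauchy (\<lambda>n. ell2_nth (X n) i)" for i
  proof (rule metric_CauchyI)
    fix e :: real assume "0 < e"
    then obtain N where N: "\<forall>m\<ge>N. \<forall>n\<ge>N. dist (X m) (X n) < e"
      using metric_CauchyD[OF X] by blast
    have "dist (ell2_nth (X m) i) (ell2_nth (X n) i) \<le> dist (X m) (X n)" for m n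
      using ell2_nth_le_norm[of "X m - X n" i] by (simp add: dist_norm minus_ell2.rep_eq)
    then show "\<exists>M. \<forall>m\<ge>M. \<forall>n\<ge>M. dist (ell2_nth (X m) i) (ell2_nth (X n) i) < e"
      using N by (meson le_less_trans)
  qed
  then have "\<forall>i. \<exists>l. (\<lambda>n. ell2_nth (X n) i) \<longlonglongrightarrow> l"
    using Cauchy_convergent convergent_def by blast
  then obtain L where L: "\<And>i. (\<lambda>n. ell2_nth (X n) i) \<longlonglongrightarrow> L i"
    by metis
  have key: "\<exists>N. \<forall>n\<ge>N. \<forall>F. finite F \<longrightarrow> (\<Sum>i\<in>F. (cmod (ell2_nth (X n) i - L i))\<^sup>2) \<le> e\<^sup>2"
    if "0 < e" for e
  proof -
    obtain N where N: "\<forall>m\<ge>N. \<forall>n\<ge>N. dist (X m) (X n) < e"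
      using metric_CauchyD[OF X \<open>0 < e\<close>] by blast
    have "(\<Sum>i\<in>F. (cmod (ell2_nth (X n) i - L i))\<^sup>2) \<le> e\<^sup>2" if "n \<ge> N" "finite F" for n F
    proof (rule LIMSEQ_le_const2)
      show "(\<lambda>m. \<Sum>i\<in>F. (cmod (ell2_nth (X n) i - ell2_nth (X m) i))\<^sup>2)
              \<longlonglongrightarrow> (\<Sum>i\<in>F. (cmod (ell2_nth (X n) i - L i))\<^sup>2)"
        by (intro tendsto_intros L)
      have "(\<Sum>i\<in>F. (cmod (ell2_nth (X n) i - ell2_nth (X m) i))\<^sup>2) \<le> e\<^sup>2" if "m \<ge> N" for m
      proof -
        have "(\<Sum>i\<in>F. (cmod (ell2_nth (X n - X m) i))\<^sup>2) \<le> (norm (X n - X m))\<^sup>2"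
          by (rule ell2_finite_sum_le) fact
        also have "\<dots> \<le> e\<^sup>2"
          using N \<open>n \<ge> N\<close> \<open>m \<ge> N\<close> by (intro power_mono) (auto simp: dist_norm less_imp_le)
        finally show ?thesis by (simp add: minus_ell2.rep_eq)
      qed
      then show "\<exists>M. \<forall>m\<ge>M. (\<Sum>i\<in>F. (cmod (ell2_nth (X n) i - ell2_nth (X m) i))\<^sup>2) \<le> e\<^sup>2"
        by blast
    qed
    then show ?thesis by blast
  qed
  obtain N where N: "\<And>F. finite F \<Longrightarrow> (\<Sum>i\<in>F. (cmod (ell2_nth (X N) i - L i))\<^sup>2) \<le> 1\<^sup>2"
    using key[of 1] by auto
  have "(\<lambda>i. (cmod (ell2_nth (X N) i - L i))\<^sup>2) summable_on UNIV"
    by (rule nonneg_bdd_above_summable_on) (auto intro!: bdd_aboveI[of _ 1] dest: N)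
  then have "(\<lambda>i. (cmod (- (ell2_nth (X N) i - L i)))\<^sup>2) summable_on UNIV"
    by (simp only: norm_minus_cancel)
  from square_summable_add[OF ell2_summable[of "X N"] this]
  have "(\<lambda>i. (cmod (L i))\<^sup>2) summable_on UNIV" by simp
  then have L': "ell2_nth (Abs_ell2 L) = L"
    by (simp add: Abs_ell2_inverse)
  have "X \<longlonglongrightarrow> Abs_ell2 L"
  proof (rule metric_LIMSEQ_I)
    fix e :: real assume "0 < e"
    then obtain N where N: "\<And>n F. n \<ge> N \<Longrightarrow> finite F \<Longrightarrow>
        (\<Sum>i\<in>F. (cmod (ell2_nth (X n) i - L i))\<^sup>2) \<le> (e/2)\<^sup>2"
      using key[of "e/2"] by auto
    have "norm (X n - Abs_ell2 L) \<le> e/2" if "n \<ge> N" for n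
      using N[OF that] \<open>0 < e\<close> by (intro ell2_norm_leI) (simp_all add: minus_ell2.rep_eq L')
    then show "\<exists>N. \<forall>n\<ge>N. dist (X n) (Abs_ell2 L) < e"
      using \<open>0 < e\<close> by (intro exI[of _ N]) (fastforce simp: dist_norm)
  qed
  then show "convergent X" by (rule convergentI)
qed

text \<open>
  The finite type \<open>'d\<close> indexes the variables, so that \<open>d = CARD('d) \<ge> 1\<close>.  Multi-indices are
  the elements of \<open>'d \<Rightarrow>\<^sub>0 nat\<close> (for finite \<open>'d\<close> these are all functions from \<open>'d\<close> to the natural
  numbers), and \<open>\<epsilon>\<^sub>j\<close> is \<open>Poly_Mapping.single j 1\<close>.
\<close>

type_synonym 'd multi_index = "'d \<Rightarrow>\<^sub>0 nat"
type_synonym 'd polynomial = "'d multi_index \<Rightarrow>\<^sub>0 complex"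

definition eval_poly :: "'d::finite polynomial \<Rightarrow> ('d \<Rightarrow> complex) \<Rightarrow> complex" where
  "eval_poly p z =
     (\<Sum>I\<in>Poly_Mapping.keys p. Poly_Mapping.lookup p I * (\<Prod>j\<in>UNIV. z j ^ Poly_Mapping.lookup I j))"

definition commuting :: "('d \<Rightarrow> 'a \<Rightarrow> 'a) \<Rightarrow> bool" where
  "commuting T \<longleftrightarrow> (\<forall>j k. T j \<circ> T k = T k \<circ> T j)"

text \<open>
  The composition of the powers \<open>T j ^^ I j\<close> over all \<open>j\<close>; for commuting \<open>T\<close> the order in which
  \<open>Finite_Set.fold\<close> takes the factors does not matter.
\<close>

definition op_monomial :: "('d::finite \<Rightarrow> 'a \<Rightarrow> 'a) \<Rightarrow> 'd multi_index \<Rightarrow> 'a \<Rightarrow> 'a" where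
  "op_monomial T I = Finite_Set.fold (\<lambda>j f. (T j ^^ Poly_Mapping.lookup I j) \<circ> f) id UNIV"

definition op_poly ::
    "'d::finite polynomial \<Rightarrow> ('d \<Rightarrow> 'a \<Rightarrow> 'a) \<Rightarrow> 'a \<Rightarrow> 'a::complex_inner" where
  "op_poly p T x = (\<Sum>I\<in>Poly_Mapping.keys p. Poly_Mapping.lookup p I *\<^sub>C op_monomial T I x)"

lemma commuting_funpow:
  assumes "commuting T"
  shows "(T j ^^ m) \<circ> (T k ^^ n) = (T k ^^ n) \<circ> (T j ^^ m)"
proof -
  have comm: "f \<circ> (g ^^ n) = (g ^^ n) \<circ> f" if fg: "f \<circ> g = g \<circ> f" for f g :: "'b \<Rightarrow> 'b" and n
  proof (induction n)
    case (Suc n)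
    have "f \<circ> (g ^^ Suc n) = (f \<circ> g) \<circ> (g ^^ n)" by (simp only: funpow.simps comp_assoc)
    also have "\<dots> = g \<circ> (f \<circ> (g ^^ n))" by (simp only: fg comp_assoc)
    also have "\<dots> = (g ^^ Suc n) \<circ> f" by (simp only: Suc.IH funpow.simps comp_assoc)
    finally show ?case .
  qed simp
  have "T j \<circ> T k = T k \<circ> T j"
    using assms by (simp add: commuting_def)
  from comm[OF comm[OF this, symmetric]] show ?thesis
    by (rule sym)
qed

lemma comp_fun_commute_powers:
  fixes T :: "'d \<Rightarrow> 'a \<Rightarrow> 'a"
  assumes "commuting T"
  shows "comp_fun_commute (\<lambda>j (f :: 'a \<Rightarrow> 'a). (T j ^^ I j) \<circ> f)"
proof (rule comp_fun_commute.intro, rule ext)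
  fix j k and g :: "'a \<Rightarrow> 'a"
  have "(T j ^^ I j) \<circ> ((T k ^^ I k) \<circ> g) = ((T j ^^ I j) \<circ> (T k ^^ I k)) \<circ> g"
    by (rule comp_assoc[symmetric])
  also have "\<dots> = ((T k ^^ I k) \<circ> (T j ^^ I j)) \<circ> g"
    by (rule arg_cong[where f = "\<lambda>h. h \<circ> g"], rule commuting_funpow[OF assms])
  also have "\<dots> = (T k ^^ I k) \<circ> ((T j ^^ I j) \<circ> g)"
    by (rule comp_assoc)
  finally show "((\<lambda>f. (T j ^^ I j) \<circ> f) \<circ> (\<lambda>f. (T k ^^ I k) \<circ> f)) g
      = ((\<lambda>f. (T k ^^ I k) \<circ> f) \<circ> (\<lambda>f. (T j ^^ I j) \<circ> f)) g"
    by (simp only: comp_apply)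
qed

lemma op_monomial_zero:
  fixes T :: "'a::finite \<Rightarrow> 'b \<Rightarrow> 'b"
  shows "op_monomial T 0 = id"
proof -
  have "Finite_Set.fold (\<lambda>j f. f) id A = (id :: 'b \<Rightarrow> 'b)" if "finite A" for A :: "'a set"
  proof -
    interpret c: comp_fun_commute "\<lambda>(j::'a) (f :: 'b \<Rightarrow> 'b). f" by standard (rule refl)
    show ?thesis using that by (induction A) simp_all
  qed
  from this[of UNIV] show ?thesis by (simp add: op_monomial_def)
qed

lemma op_monomial_add_single:
  fixes T :: "'d::finite \<Rightarrow> 'a \<Rightarrow> 'a"
  assumes "commuting T"
  shows "op_monomial T (I + Poly_Mapping.single k 1) = T k \<circ> op_monomial T I"
proof -
  define F where "F I = (\<lambda>j (g :: 'a \<Rightarrow> 'a). (T j ^^ Poly_Mapping.lookup I j) \<circ> g)" for I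
  have F: "comp_fun_commute (F I)" for I
    unfolding F_def by (rule comp_fun_commute_powers[OF assms])
  then have F': "comp_fun_commute_on UNIV (F I)" for I
    by (simp only: comp_fun_commute_def')
  have monom: "op_monomial T I = F I k (Finite_Set.fold (F I) id (UNIV - {k}))" for I
    using comp_fun_commute_on.fold_rec[OF F', of UNIV k I id]
    by (simp add: op_monomial_def F_def)
  have same: "Finite_Set.fold (F (I + Poly_Mapping.single k 1)) id (UNIV - {k})
      = Finite_Set.fold (F I) id (UNIV - {k})"
    by (rule Finite_Set.fold_cong[OF F' F']) (auto simp: F_def lookup_add lookup_single)
  have "F (I + Poly_Mapping.single k 1) k g = T k \<circ> F I k g" for g
    by (simp add: F_def lookup_add comp_assoc)
  then show ?thesis
    by (simp only: monom same)
qed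

definition weighted_shift ::
    "('d::finite multi_index \<Rightarrow> 'h::complex_inner) \<Rightarrow> ('d multi_index \<Rightarrow> 'd \<Rightarrow> real) \<Rightarrow>
     ('d \<Rightarrow> 'h \<Rightarrow> 'h) \<Rightarrow> bool" where
  "weighted_shift e w T \<longleftrightarrow>
     orthonormal_basis e \<and>
     (\<forall>I j. 0 < w I j) \<and>
     bounded (range (\<lambda>(I, j). w I j)) \<and>
     (\<forall>I j k. w I j * w (I + Poly_Mapping.single j 1) k = w I k * w (I + Poly_Mapping.single k 1) j) \<and>
     (\<forall>j. bounded_operator (T j)) \<and>
     (\<forall>I j. T j (e I) = w I j *\<^sub>R e (I + Poly_Mapping.single j 1))"

text \<open>
  That \<open>H\<close> is a closed subspace of \<open>K\<close> is expressed by an isometric embedding \<open>V\<close>, whose range is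
  closed because \<open>H\<close> is complete.
\<close>

definition unitary_dilation ::
    "('d::finite \<Rightarrow> 'h \<Rightarrow> 'h) \<Rightarrow> ('h::chilbert_space \<Rightarrow> 'k::chilbert_space) \<Rightarrow> ('d \<Rightarrow> 'k \<Rightarrow> 'k) \<Rightarrow> bool"
  where
  "unitary_dilation T V U \<longleftrightarrow>
     isometric V \<and> (\<forall>j. unitary (U j)) \<and> commuting U \<and>
     (\<forall>p h. V (op_poly p T h) = orthogonal_projection (range V) (op_poly p U (V h)))"

text \<open>
  A definition cannot quantify over the type of \<open>K\<close>.  No generality is lost by taking \<open>K\<close> to be
  \<open>\<ell>\<^sup>2\<close> over the set of elements of \<open>H\<close>: in an arbitrary dilation, the smallest closed subspace
  that contains \<open>H\<close> and reduces all \<open>U j\<close> has a dense subset of at most the cardinality of \<open>H\<close>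
  (if \<open>H\<close> is nonzero), so it embeds isometrically into this space, and the unitaries extend by the
  identity on the orthogonal complement.
\<close>

definition dilates_to_commuting_unitaries ::
    "('d::finite \<Rightarrow> 'h \<Rightarrow> 'h::chilbert_space) \<Rightarrow> bool" where
  "dilates_to_commuting_unitaries T \<longleftrightarrow>
     commuting T \<and> (\<exists>(V :: 'h \<Rightarrow> 'h ell2) U. unitary_dilation T V U)"

end

theory Submission
  imports Defs
begin

text \<open>
  The weights are the quotients of a single function: with \<open>\<beta> I = \<parallel>T\<^sup>I e\<^sub>0\<parallel>\<close> one has
  \<open>T\<^sup>K e\<^sub>I = (\<beta> (I + K) / \<beta> I) e\<^bsub>I + K\<^esub>\<close>, and the \<open>T\<^sub>j\<close> being contractions means that
  \<open>\<beta>\<close> takes values in \<open>(0, 1]\<close> and decreases along the order of multi-indices.  Hence the quotient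
  \<open>\<beta> J / \<beta> I\<close> for \<open>I \<le> J\<close> is the value at \<open>(I, J)\<close> of the kernel
  \<open>min (\<beta> I) (\<beta> J) / max (\<beta> I) (\<beta> J) = min (\<beta> I\<^sup>2) (\<beta> J\<^sup>2) / (\<beta> I \<beta> J)\<close>.  This kernel is positive
  definite, because \<open>min s t\<close> is the covariance of Brownian motion: it is the inner product of
  the indicator functions of \<open>[0, s]\<close> and \<open>[0, t]\<close>.  So there are unit vectors \<open>v\<^sub>I\<close> in some
  Hilbert space \<open>L\<close> with \<open>\<langle>v\<^sub>I, v\<^sub>J\<rangle> = \<beta> J / \<beta> I\<close> whenever \<open>I \<le> J\<close>.

  In \<open>L \<otimes> \<ell>\<^sup>2(\<int>\<^sup>d)\<close> let \<open>U\<^sub>j\<close> be the shift of the second factor by \<open>\<epsilon>\<^sub>j\<close>, and let \<open>V\<close> send \<open>e\<^sub>I\<close> to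
  \<open>v\<^sub>I \<otimes> \<delta>\<^sub>I\<close>.  The images are orthonormal, so \<open>V\<close> is an isometry, and
  \<open>\<langle>U\<^sup>K V e\<^sub>I, V e\<^sub>J\<rangle>\<close> vanishes unless \<open>J = I + K\<close>, when it equals \<open>\<beta> J / \<beta> I\<close>.  These are the matrix
  coefficients of \<open>T\<^sup>K\<close>, so the commuting unitaries \<open>U\<^sub>j\<close> dilate \<open>T\<close>.  The carrying lemmas are
  \<open>weighted_shift_moments\<close> (the function \<open>\<beta>\<close>), \<open>brownian_vectors\<close> and \<open>ratio_kernel_vectors\<close> (the
  vectors \<open>v\<^sub>I\<close>), \<open>lattice_shift_unitaries\<close> (the shifts) and \<open>weak_dilation_from_basis\<close> (from basis
  vectors to all vectors).  The dilation space has to be \<open>\<ell>\<^sup>2\<close> over the elements of the given space; with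
  \<open>L = \<ell>\<^sup>2(\<nat>)\<close>, an injection of \<open>\<nat> \<times> \<int>\<^sup>d\<close> into that index set puts the tensor product there, and the
  unitaries act as the identity on the remaining coordinates.

  Von Neumann's inequality passes from \<open>U\<close> to \<open>T\<close> by the dilation.  For commuting isometries it is
  proved by harmonic analysis on finite tori, in place of the spectral theorem: the trigonometric
  polynomial \<open>\<Sum>\<^bsub>n\<^esub> z\<^bsup>-n\<^esup> U\<^sup>n x\<close>, summed over a large box, is an approximate joint
  eigenvector of \<open>U\<close> with eigenvalue \<open>z\<close>, and Parseval's identity bounds \<open>p(U) x\<close> by the average over
  roots of unity, with an error that disappears as the box grows
  (\<open>isometries_box_estimate\<close>).
\<close>

section \<open>Complex inner product spaces\<close>

lemma cinner_add_right: "cinner x (y + z) = cinner x y + cinner x z"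
  for x :: "'a::complex_inner"
  by (metis cinner_add_left cinner_commute complex_cnj_add)

lemma cinner_scaleC_right: "cinner x (a *\<^sub>C y) = cnj a * cinner x y"
  for x :: "'a::complex_inner"
  by (metis cinner_commute cinner_scaleC_left complex_cnj_mult)

lemma cinner_zero_left [simp]: "cinner 0 x = 0"
  for x :: "'a::complex_inner"
  using cinner_add_left[of 0 0 x] by simp

lemma cinner_zero_right [simp]: "cinner x 0 = 0"
  for x :: "'a::complex_inner"
  using cinner_add_right[of x 0 0] by simp

lemma cinner_diff_left: "cinner (x - y) z = cinner x z - cinner y z"
  for x :: "'a::complex_inner"
  using cinner_add_left[of "x - y" y z] by simp

lemma cinner_diff_right: "cinner x (y - z) = cinner x y - cinner x z"
  for x :: "'a::complex_inner"
  using cinner_add_right[of x "y - z" z] by simp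

lemma cinner_sum_left: "cinner (sum f A) y = (\<Sum>a\<in>A. cinner (f a) y)"
  for y :: "'a::complex_inner"
  by (induction A rule: infinite_finite_induct) (simp_all add: cinner_add_left)

lemma cinner_sum_right: "cinner y (sum f A) = (\<Sum>a\<in>A. cinner y (f a))"
  for y :: "'a::complex_inner"
  by (induction A rule: infinite_finite_induct) (simp_all add: cinner_add_right)

lemma cinner_scaleR_left: "cinner (r *\<^sub>R x) y = of_real r * cinner x y"
  for x :: "'a::complex_inner"
  by (simp add: scaleR_scaleC cinner_scaleC_left)

lemma cinner_scaleR_right: "cinner x (r *\<^sub>R y) = of_real r * cinner x y"
  for x :: "'a::complex_inner"
  by (simp add: scaleR_scaleC cinner_scaleC_right)

lemma cinner_self: "cinner x x = of_real ((norm x)\<^sup>2)"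
  for x :: "'a::complex_inner"
proof (rule complex_eqI)
  show "Re (cinner x x) = Re (of_real ((norm x)\<^sup>2))"
    by (simp add: power2_norm_eq_inner inner_eq_Re_cinner)
  have "Im (cinner x x) = - Im (cinner x x)"
    by (metis cinner_commute cnj.sel(2))
  then show "Im (cinner x x) = Im (of_real ((norm x)\<^sup>2))" by simp
qed

lemma norm_scaleC: "norm (a *\<^sub>C x) = cmod a * norm x"
  for x :: "'a::complex_inner"
proof -
  have "of_real ((norm (a *\<^sub>C x))\<^sup>2) = a * cnj a * cinner x x"
    unfolding cinner_self[symmetric] by (simp add: cinner_scaleC_left cinner_scaleC_right)
  also have "\<dots> = of_real ((cmod a * norm x)\<^sup>2)"
    by (simp add: cinner_self complex_norm_square power_mult_distrib flip: complex_norm_square)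
  finally have "(norm (a *\<^sub>C x))\<^sup>2 = (cmod a * norm x)\<^sup>2"
    using of_real_eq_iff by blast
  then show ?thesis by (simp add: power2_eq_iff_nonneg)
qed

lemma Re_cinner_le: "Re (cinner x y) \<le> norm x * norm y"
  for x :: "'a::complex_inner"
  using norm_cauchy_schwarz[of x y] by (simp add: inner_eq_Re_cinner)

lemma continuous_on_scaleC:
  fixes f :: "'a::topological_space \<Rightarrow> 'b::complex_inner"
  assumes "continuous_on S f"
  shows "continuous_on S (\<lambda>s. a *\<^sub>C f s)"
proof -
  have "bounded_linear (\<lambda>x :: 'b. a *\<^sub>C x)"
    by (rule bounded_linear_intro[where K = "cmod a"])
       (simp_all add: scaleC_add_right scaleR_scaleC scaleC_scaleC norm_scaleC mult.commute)
  then show ?thesis by (rule bounded_linear.continuous_on) fact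
qed

text \<open>
  Both parts of the complex inner product are real inner products, so its continuity is inherited
  from the real one.
\<close>

lemma cinner_eq_Complex: "cinner x y = Complex (inner x y) (inner x (\<i> *\<^sub>C y))"
  for x :: "'a::complex_inner"
  by (simp add: complex_eq_iff inner_eq_Re_cinner cinner_scaleC_right)

lemma continuous_on_cinner:
  fixes f g :: "'a::topological_space \<Rightarrow> 'b::complex_inner"
  assumes "continuous_on S f" "continuous_on S g"
  shows "continuous_on S (\<lambda>s. cinner (f s) (g s))"
  unfolding cinner_eq_Complex Complex_eq
  by (intro continuous_intros continuous_on_scaleC assms)

lemma clinear_iff:
  fixes f :: "'a::complex_inner \<Rightarrow> 'b::complex_inner"
  shows "clinear f \<longleftrightarrow> (\<forall>x y. f (x + y) = f x + f y) \<and> (\<forall>c x. f (c *\<^sub>C x) = c *\<^sub>C f x)"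
  by (simp add: Vector_Spaces.linear_iff complex_vector.vector_space_axioms)

lemma clinear_diff:
  fixes f :: "'a::complex_inner \<Rightarrow> 'b::complex_inner"
  assumes "clinear f"
  shows "f (x - y) = f x - f y"
  using assms unfolding clinear_iff by (metis add_diff_cancel diff_add_cancel)

lemma clinear_scaleR:
  fixes f :: "'a::complex_inner \<Rightarrow> 'b::complex_inner"
  assumes "clinear f"
  shows "f (r *\<^sub>R x) = r *\<^sub>R f x"
  using assms by (simp add: clinear_iff scaleR_scaleC)

lemma clinear_zero:
  fixes f :: "'a::complex_inner \<Rightarrow> 'b::complex_inner"
  assumes "clinear f"
  shows "f 0 = 0"
  using clinear_diff[OF assms, of 0 0] by simp

lemma clinear_sum:
  fixes f :: "'a::complex_inner \<Rightarrow> 'b::complex_inner"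
  assumes "clinear f"
  shows "f (sum g A) = (\<Sum>a\<in>A. f (g a))"
  using assms by (induction A rule: infinite_finite_induct) (simp_all add: clinear_zero clinear_iff)

lemma isometric_norm: "isometric V \<Longrightarrow> norm (V x) = norm x"
  by (simp add: isometric_def norm_eq_sqrt_inner inner_eq_Re_cinner)

lemma isometric_bounded_linear:
  assumes "isometric V"
  shows "bounded_linear V"
proof (rule bounded_linear_intro[where K = 1])
  have "clinear V" using assms by (simp add: isometric_def)
  then show "V (x + y) = V x + V y" "V (r *\<^sub>R x) = r *\<^sub>R V x" for x y r
    by (simp_all add: clinear_iff scaleR_scaleC)
qed (simp add: isometric_norm[OF assms])

text \<open>
  The two defining properties determine the projection because the difference of two candidates
  lies in the subspace and is orthogonal to it.
\<close>

lemma orthogonal_projection_eqI: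
  fixes M :: "'a::complex_inner set"
  assumes "y \<in> M" "\<And>m. m \<in> M \<Longrightarrow> cinner (x - y) m = 0"
    and diff: "\<And>a b. a \<in> M \<Longrightarrow> b \<in> M \<Longrightarrow> a - b \<in> M"
  shows "orthogonal_projection M x = y"
  unfolding orthogonal_projection_def
proof (rule the_equality)
  show "y \<in> M \<and> (\<forall>m\<in>M. cinner (x - y) m = 0)" using assms by blast
  fix z assume z: "z \<in> M \<and> (\<forall>m\<in>M. cinner (x - z) m = 0)"
  then have "z - y \<in> M" using assms(1) diff by blast
  then have "cinner (x - y) (z - y) - cinner (x - z) (z - y) = 0" using z assms(2) by simp
  then have "cinner (z - y) (z - y) = 0" by (simp flip: cinner_diff_left)
  then show "z = y" by (simp add: cinner_self)
qed

text \<open>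
  Induction over an orthonormal basis: linear identities between continuous operators need only
  be checked on basis vectors.
\<close>

lemma orthonormal_basis_density:
  fixes e :: "'i \<Rightarrow> 'a::complex_inner"
  assumes e: "orthonormal_basis e"
    and sub: "complex_vector.subspace {x. P x}" and closed: "closed {x. P x}"
    and basis: "\<And>i. P (e i)"
  shows "P x"
proof -
  have "cspan (range e) \<subseteq> {x. P x}"
    by (rule complex_vector.span_minimal) (use sub basis in auto)
  then have "closure (cspan (range e)) \<subseteq> {x. P x}"
    using closed by (rule closure_minimal)
  then show ?thesis
    using e by (auto simp: orthonormal_basis_def)
qed

lemma orthonormal_independent:
  fixes e :: "'i \<Rightarrow> 'a::complex_inner"
  assumes "\<And>i j. cinner (e i) (e j) = (if i = j then 1 else 0)"
  shows "\<not> complex_vector.dependent (range e)"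
  unfolding complex_vector.independent_explicit_module
proof (intro allI impI)
  fix t u v
  assume t: "finite t" "t \<subseteq> range e" and sum: "(\<Sum>v\<in>t. u v *\<^sub>C v) = 0" and v: "v \<in> t"
  have *: "cinner x v = (if x = v then 1 else 0)" if x: "x \<in> t" for x
  proof -
    obtain i j where ij: "x = e i" "v = e j" using x t(2) v by blast
    then have "x = v \<longleftrightarrow> i = j" by (metis assms zero_neq_one)
    then show ?thesis by (simp add: ij assms)
  qed
  have "0 = cinner (\<Sum>v\<in>t. u v *\<^sub>C v) v" by (simp add: sum)
  also have "\<dots> = (\<Sum>x\<in>t. if x = v then u v else 0)"
    unfolding cinner_sum_left by (rule sum.cong) (auto simp: cinner_scaleC_left *)
  finally show "u v = 0" using t v by simp
qed

text \<open>
  The linear extension to the span preserves inner products, so it is uniformly continuous and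
  extends to the closure of the span, which is the whole space; linearity and preservation of
  inner products survive the limit.
\<close>

lemma isometric_extension:
  fixes e :: "'i \<Rightarrow> 'a::complex_inner" and b :: "'i \<Rightarrow> 'b::chilbert_space"
  assumes e: "orthonormal_basis e"
    and b: "\<And>i j. cinner (b i) (b j) = (if i = j then 1 else 0)"
  shows "\<exists>V. isometric V \<and> (\<forall>i. V (e i) = b i)"
proof -
  interpret pair: vector_space_pair "scaleC :: complex \<Rightarrow> 'a \<Rightarrow> 'a" "scaleC :: complex \<Rightarrow> 'b \<Rightarrow> 'b" ..
  let ?S = "cspan (range e)"
  have ee: "cinner (e i) (e j) = (if i = j then 1 else 0)" for i j
    using e by (simp add: orthonormal_basis_def)
  have "inj e"
    by (rule injI) (metis ee zero_neq_one)
  obtain g where g: "clinear g" "\<forall>x\<in>range e. g x = (b \<circ> inv e) x"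
    using pair.linear_independent_extend[OF orthonormal_independent[OF ee]] by blast
  have gb: "g (e i) = b i" for i
    using g(2) \<open>inj e\<close> by simp
  \<comment> \<open>Span induction in one argument at a time: first against basis vectors, then in general.\<close>
  have iso1: "cinner (g x) (b j) = cinner x (e j)" if "x \<in> ?S" for x j
    using that
    by (rule complex_vector.span_induct)
       (auto simp: complex_vector.subspace_def g(1)[unfolded clinear_iff] clinear_zero[OF g(1)]
         cinner_add_left cinner_scaleC_left gb b ee)
  have iso: "cinner (g x) (g y) = cinner x y" if "x \<in> ?S" "y \<in> ?S" for x y
    using that(2)
    by (rule complex_vector.span_induct)
       (auto simp: complex_vector.subspace_def g(1)[unfolded clinear_iff] clinear_zero[OF g(1)]
         cinner_add_right cinner_scaleC_right gb iso1[OF that(1)])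
  have dist: "dist (g x) (g y) = dist x y" if "x \<in> ?S" "y \<in> ?S" for x y
    using iso[of "x - y" "x - y"] complex_vector.span_diff[OF that]
    by (simp add: dist_norm clinear_diff[OF g(1)] norm_eq_sqrt_inner inner_eq_Re_cinner)
  then have "uniformly_continuous_on ?S g"
    unfolding uniformly_continuous_on_def by (metis)
  then obtain V where V: "uniformly_continuous_on (closure ?S) V" "\<And>x. x \<in> ?S \<Longrightarrow> g x = V x"
    using uniformly_continuous_on_extension_on_closure[of ?S g] by metis
  have cont: "continuous_on UNIV V"
    using uniformly_continuous_imp_continuous[OF V(1)] e by (simp add: orthonormal_basis_def)
  have approx: "\<exists>xs. (\<forall>n. xs n \<in> ?S) \<and> xs \<longlonglongrightarrow> x" for x
    using e by (metis UNIV_I closure_sequential orthonormal_basis_def)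
  have lim: "(\<lambda>n. V (xs n)) \<longlonglongrightarrow> V x" if "xs \<longlonglongrightarrow> x" for xs x
    using cont that by (metis continuous_on_tendsto_compose UNIV_I eventually_sequentially)
  have add: "V (x + y) = V x + V y" for x y
  proof -
    obtain xs ys where s: "\<forall>n. xs n \<in> ?S" "xs \<longlonglongrightarrow> x" "\<forall>n. ys n \<in> ?S" "ys \<longlonglongrightarrow> y"
      using approx by meson
    have "V (xs n + ys n) = V (xs n) + V (ys n)" for n
      using s g(1) complex_vector.span_add[of "xs n" _ "ys n"] by (simp add: clinear_iff flip: V(2))
    then have "(\<lambda>n. V (xs n + ys n)) \<longlonglongrightarrow> V x + V y"
      using tendsto_add[OF lim[OF s(2)] lim[OF s(4)]] by simp
    then show ?thesis
      using lim[OF tendsto_add[OF s(2,4)]] LIMSEQ_unique by blast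
  qed
  have sc: "V (c *\<^sub>C x) = c *\<^sub>C V x" for c x
  proof -
    obtain xs where s: "\<forall>n. xs n \<in> ?S" "xs \<longlonglongrightarrow> x"
      using approx by meson
    have c: "(\<lambda>n. c *\<^sub>C zs n) \<longlonglongrightarrow> c *\<^sub>C z" if "zs \<longlonglongrightarrow> z" for zs and z :: "'z::complex_inner"
      using continuous_on_tendsto_compose[OF continuous_on_scaleC[OF continuous_on_id, of UNIV c] that]
      by simp
    have "V (c *\<^sub>C xs n) = c *\<^sub>C V (xs n)" for n
      using s g(1) complex_vector.span_scale[of "xs n" _ c] by (simp add: clinear_iff flip: V(2))
    then have "(\<lambda>n. V (c *\<^sub>C xs n)) \<longlonglongrightarrow> c *\<^sub>C V x"
      using c[OF lim[OF s(2)]] by simp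
    then show ?thesis
      using lim[OF c[OF s(2)]] LIMSEQ_unique by blast
  qed
  have "clinear V" using add sc by (simp add: clinear_iff)
  moreover have "cinner (V x) (V y) = cinner x y" for x y
  proof -
    have 1: "cinner (V x) (b j) = cinner x (e j)" for x j
      by (rule orthonormal_basis_density[OF e])
         (auto simp: complex_vector.subspace_def add sc clinear_zero[OF \<open>clinear V\<close>]
           cinner_add_left cinner_scaleC_left gb b ee complex_vector.span_base
           simp flip: V(2) intro!: closed_Collect_eq continuous_on_cinner cont continuous_intros)
    show ?thesis
      by (rule orthonormal_basis_density[OF e, of _ y])
         (auto simp: complex_vector.subspace_def add sc clinear_zero[OF \<open>clinear V\<close>]
           cinner_add_right cinner_scaleC_right gb 1 complex_vector.span_base
           simp flip: V(2) intro!: closed_Collect_eq continuous_on_cinner cont continuous_intros)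
  qed
  ultimately have "isometric V" by (simp add: isometric_def)
  moreover have "V (e i) = b i" for i
    by (metis V(2) complex_vector.span_base gb rangeI)
  ultimately show ?thesis by blast
qed

section \<open>Hilbert space vectors with covariance of Brownian motion\<close>

text \<open>
  A pair \<open>(s, v)\<close> in \<open>A\<close> stands for a time \<open>s\<close> and the position \<open>v\<close> of a Brownian motion at
  that time.  A further time \<open>t\<close> is inserted by conditioning on the two nearest known times \<open>lo\<close>
  and \<open>hi\<close>: the new position is the linear interpolation plus an independent noise \<open>z\<close> whose variance
  \<open>(t - lo) (hi - t) / (hi - lo)\<close> is that of the Brownian bridge.  The last conclusion says that the
  new vector lies in the span of the old ones and \<open>z\<close>, in the form in which the recursion uses it:
  further noise vectors stay independent of everything constructed so far.
\<close>

lemma brownian_bridge_step: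
  fixes z :: "'a::complex_inner"
  assumes fin: "finite A"
    and A: "\<And>s v s' v'. (s, v) \<in> A \<Longrightarrow> (s', v') \<in> A \<Longrightarrow> cinner v v' = of_real (min s s')"
    and below: "(0, v) \<in> A" and above: "(1, v') \<in> A" and t: "0 \<le> t" "t \<le> (1::real)"
    and z: "cinner z z = 1" "\<And>s v. (s, v) \<in> A \<Longrightarrow> cinner v z = 0"
  obtains x where "cinner x x = of_real t"
    and "\<And>s v. (s, v) \<in> A \<Longrightarrow> cinner v x = of_real (min s t)"
    and "\<And>y. cinner z y = 0 \<Longrightarrow> (\<And>s v. (s, v) \<in> A \<Longrightarrow> cinner v y = 0) \<Longrightarrow> cinner x y = 0"
proof -
  define lo where "lo = Max {s \<in> fst ` A. s \<le> t}"
  define hi where "hi = Min {s \<in> fst ` A. t \<le> s}"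
  have "lo \<in> {s \<in> fst ` A. s \<le> t}"
    unfolding lo_def using fin below t by (intro Max_in) force+
  then obtain v0 where v0: "(lo, v0) \<in> A" "lo \<le> t" by auto
  have "hi \<in> {s \<in> fst ` A. t \<le> s}"
    unfolding hi_def using fin above t by (intro Min_in) force+
  then obtain v1 where v1: "(hi, v1) \<in> A" "t \<le> hi" by auto
  have gap: "s \<le> lo \<or> hi \<le> s" if "(s, v) \<in> A" for s v
  proof (cases "s \<le> t")
    case True
    then have "s \<le> lo" unfolding lo_def using fin that by (intro Max_ge) force+
    then show ?thesis ..
  next
    case False
    then have "hi \<le> s" unfolding hi_def using fin that by (intro Min_le) force+
    then show ?thesis ..
  qed
  \<comment> \<open>If \<open>lo = hi\<close>, both coefficients are \<open>0\<close> because division by zero gives zero.\<close>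
  define c where "c = (t - lo) / (hi - lo)"
  define r where "r = sqrt ((t - lo) * (hi - t) / (hi - lo))"
  define x where "x = v0 + c *\<^sub>R (v1 - v0) + r *\<^sub>R z"
  have c: "c * (hi - lo) = t - lo"
    using v0 v1 by (simp add: c_def)
  have r: "r * r = (t - lo) * (hi - t) / (hi - lo)"
    using v0 v1 by (simp add: r_def)
  have vx: "cinner v x = of_real (min s t)" if "(s, v) \<in> A" for s v
  proof -
    have "cinner v x = of_real (min s lo + c * (min s hi - min s lo))"
      by (simp add: x_def cinner_add_right cinner_diff_right cinner_scaleR_right
          A[OF that v0(1)] A[OF that v1(1)] z(2)[OF that])
    also have "min s lo + c * (min s hi - min s lo) = min s t"
    proof (cases "s \<le> lo")
      case True
      then have "min s lo = s" "min s hi = s" "min s t = s"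
        using v0(2) v1(2) by linarith+
      then show ?thesis by (simp only:) simp
    next
      case False
      then have "hi \<le> s" using gap[OF that] by blast
      then have "min s lo = lo" "min s hi = hi" "min s t = t"
        using v0(2) v1(2) by linarith+
      then show ?thesis using c by (simp only:)
    qed
    finally show ?thesis .
  qed
  have zx: "cinner z x = of_real r"
  proof -
    have "cinner z v0 = 0" "cinner z v1 = 0"
      using z(2)[OF v0(1)] z(2)[OF v1(1)] by (metis cinner_commute complex_cnj_zero)+
    then show ?thesis
      by (simp add: x_def cinner_add_right cinner_diff_right cinner_scaleR_right z)
  qed
  have "cinner x x = cinner v0 x + c * (cinner v1 x - cinner v0 x) + r * cinner z x"
    by (subst x_def) (simp add: cinner_add_left cinner_diff_left cinner_scaleR_left)
  also have "\<dots> = of_real (lo + c * (t - lo) + r * r)"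
    using v0 v1 by (simp add: vx[OF v0(1)] vx[OF v1(1)] zx min_def)
  also have "lo + c * (t - lo) + r * r = t"
  proof (cases "hi = lo")
    case False
    have "c * (t - lo) + r * r = ((t - lo) * (hi - lo)) / (hi - lo)"
      unfolding c_def r add_divide_distrib[symmetric] times_divide_eq_left
      by (simp add: algebra_simps)
    then show ?thesis using False by simp
  qed (use v0 v1 r in auto)
  finally have "cinner x x = of_real t" .
  moreover have "cinner x y = 0"
    if "cinner z y = 0" and "\<And>s v. (s, v) \<in> A \<Longrightarrow> cinner v y = 0" for y
    using that(1) that(2)[OF v0(1)] that(2)[OF v1(1)]
    by (simp add: x_def cinner_add_left cinner_diff_left cinner_scaleR_left)
  ultimately show thesis using vx that by blast
qed

text \<open>
  The times are inserted one after the other.  The recursion starts with the pairs \<open>(0, 0)\<close> and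
  \<open>(1, b 0)\<close>, so that each new time has neighbours on both sides, and step \<open>n\<close> consumes the noise
  vector \<open>b (Suc n)\<close>.
\<close>

lemma brownian_vectors:
  fixes t :: "nat \<Rightarrow> real" and b :: "nat \<Rightarrow> 'a::complex_inner"
  assumes t: "\<And>n. 0 \<le> t n" "\<And>n. t n \<le> 1"
    and b: "\<And>m n. cinner (b m) (b n) = (if m = n then 1 else 0)"
  shows "\<exists>u :: nat \<Rightarrow> 'a. \<forall>m n. cinner (u m) (u n) = of_real (min (t m) (t n))"
proof -
  define A where "A f n = {(0, 0), (1, b 0)} \<union> (\<lambda>i. (t i, f i)) ` {..<n}" for f n
  define P where "P f n x \<longleftrightarrow> cinner x x = of_real (t n) \<and>
      (\<forall>(s, v)\<in>A f n. cinner v x = of_real (min s (t n))) \<and>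
      (\<forall>k>Suc n. cinner x (b k) = 0)" for f n x
  have "\<exists>u. \<forall>n. P u n (u n)"
  proof (rule dependent_wellorder_choice)
    fix r n and f g :: "nat \<Rightarrow> 'a" assume "\<And>i. i < n \<Longrightarrow> f i = g i"
    then have "A f n = A g n" unfolding A_def by auto
    then show "P f n r = P g n r" unfolding P_def by simp
  next
    fix n f assume IH: "\<And>i. i < n \<Longrightarrow> P f i (f i)"
    have lt: "cinner (f i) (f j) = of_real (min (t i) (t j))" if "i < j" "j < n" for i j
    proof -
      have "(t i, f i) \<in> A f j" using that by (auto simp: A_def)
      then show ?thesis using IH[OF that(2)] by (auto simp: P_def)
    qed
    have ff: "cinner (f i) (f j) = of_real (min (t i) (t j))" if "i < n" "j < n" for i j
    proof (cases i j rule: linorder_cases)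
      case less then show ?thesis using lt that by blast
    next
      case equal then show ?thesis using IH[OF that(1)] by (simp add: P_def)
    next
      case greater
      then show ?thesis using lt[OF greater that(1)]
        by (subst cinner_commute) (simp add: min.commute)
    qed
    have bf: "cinner (b 0) (f i) = of_real (t i)" if "i < n" for i
    proof -
      have "(1, b 0) \<in> A f i" by (auto simp: A_def)
      then show ?thesis using IH[OF that] t(2)[of i] by (auto simp: P_def min_def)
    qed
    have fb: "cinner (f i) (b 0) = of_real (t i)" if "i < n" for i
      using bf[OF that] by (subst cinner_commute) simp
    have kernel: "cinner v v' = of_real (min s s')" if "(s, v) \<in> A f n" "(s', v') \<in> A f n" for s v s' v'
    proof -
      have cases: "s = 0 \<and> v = 0 \<or> s = 1 \<and> v = b 0 \<or> (\<exists>i<n. s = t i \<and> v = f i)"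
        if "(s, v) \<in> A f n" for s v
        using that by (auto simp: A_def)
      have min: "min 0 (t i) = 0" "min (t i) 0 = 0" "min 1 (t i) = t i" "min (t i) 1 = t i" for i
        using t by (simp_all only: min_absorb1 min_absorb2)
      show ?thesis
        using cases[OF that(1)] cases[OF that(2)]
        by (elim disjE exE conjE) (simp_all add: ff bf fb b min)
    qed
    have ortho: "cinner v (b k) = 0" if "(s, v) \<in> A f n" "k > n" for s v k
      using that IH by (auto simp: A_def P_def b)
    have A0: "finite (A f n)" "(0, 0) \<in> A f n" "(1, b 0) \<in> A f n"
      by (auto simp: A_def)
    obtain x where "cinner x x = of_real (t n)"
      "\<And>s v. (s, v) \<in> A f n \<Longrightarrow> cinner v x = of_real (min s (t n))"
      "\<And>y. cinner (b (Suc n)) y = 0 \<Longrightarrow> (\<And>s v. (s, v) \<in> A f n \<Longrightarrow> cinner v y = 0) \<Longrightarrow> cinner x y = 0"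
    proof (rule brownian_bridge_step[where z = "b (Suc n)" and t = "t n"])
      show "cinner v (b (Suc n)) = 0" if "(s, v) \<in> A f n" for s v
        using ortho[OF that] by simp
      show "cinner v v' = of_real (min s s')" if "(s, v) \<in> A f n" "(s', v') \<in> A f n" for s v s' v'
        using kernel that .
    qed (use A0 t b in auto)
    then have "P f n x"
      unfolding P_def using ortho b by auto
    then show "\<exists>x. P f n x" ..
  qed
  then obtain u where u: "\<And>n. P u n (u n)" by blast
  have lt: "cinner (u i) (u j) = of_real (min (t i) (t j))" if "i < j" for i j
  proof -
    have "(t i, u i) \<in> A u j" using that by (auto simp: A_def)
    then show ?thesis using u[of j] by (auto simp: P_def)
  qed
  have "cinner (u i) (u j) = of_real (min (t i) (t j))" for i j
  proof (cases i j rule: linorder_cases)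
    case less then show ?thesis using lt by blast
  next
    case equal then show ?thesis using u[of i] by (simp add: P_def)
  next
    case greater
    then show ?thesis using lt[OF greater]
      by (subst cinner_commute) (simp add: min.commute)
  qed
  then show ?thesis by blast
qed

section \<open>Injections of index sets and unitaries that permute coordinates\<close>

lemma ell2_eqI: "(\<And>i. ell2_nth x i = ell2_nth y i) \<Longrightarrow> x = y"
  by (metis ell2_nth_inject ext)

text \<open>
  The extension by zero of a square summable family along an injection of index sets.  Bijections
  give permutation unitaries, and injections with disjoint ranges give orthogonal copies of one space
  in another; both are needed, and one functorial operation serves for both.  Outside injective \<open>f\<close> the
  value has no meaning.
\<close>

definition ell2_push :: "('a \<Rightarrow> 'b) \<Rightarrow> 'a ell2 \<Rightarrow> 'b ell2" where
  "ell2_push f x = Abs_ell2 (\<lambda>b. if b \<in> range f then ell2_nth x (inv f b) else 0)"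

lemma ell2_nth_push:
  assumes "inj f"
  shows "ell2_nth (ell2_push f x) b = (if b \<in> range f then ell2_nth x (inv f b) else 0)"
proof -
  let ?g = "\<lambda>b. if b \<in> range f then ell2_nth x (inv f b) else 0"
  have "((\<lambda>b. (cmod (?g b))\<^sup>2) \<circ> f) summable_on UNIV"
    using ell2_summable[of x UNIV] assms by (simp add: o_def)
  then have "(\<lambda>b. (cmod (?g b))\<^sup>2) summable_on range f"
    using summable_on_reindex[OF assms] by blast
  then have "(\<lambda>b. (cmod (?g b))\<^sup>2) summable_on UNIV"
    by (rule summable_on_cong_neutral[THEN iffD1, rotated -1]) auto
  then show ?thesis
    by (simp add: ell2_push_def Abs_ell2_inverse)
qed

lemma ell2_nth_push_image: "inj f \<Longrightarrow> ell2_nth (ell2_push f x) (f a) = ell2_nth x a"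
  by (simp add: ell2_nth_push)

lemma ell2_push_isometric:
  assumes "inj f"
  shows "isometric (ell2_push f)"
  unfolding isometric_def clinear_iff
proof (intro conjI allI)
  show "ell2_push f (x + y) = ell2_push f x + ell2_push f y" for x y
    by (rule ell2_eqI) (simp add: ell2_nth_push[OF assms] plus_ell2.rep_eq)
  show "ell2_push f (c *\<^sub>C x) = c *\<^sub>C ell2_push f x" for c x
    by (rule ell2_eqI) (simp add: ell2_nth_push[OF assms] scaleC_ell2.rep_eq)
  fix x y
  let ?g = "\<lambda>b. ell2_nth (ell2_push f x) b * cnj (ell2_nth (ell2_push f y) b)"
  have "infsum ?g UNIV = infsum ?g (range f)"
    by (rule infsum_cong_neutral) (auto simp: ell2_nth_push[OF assms])
  also have "\<dots> = infsum (?g \<circ> f) UNIV"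
    by (rule infsum_reindex) fact
  finally show "cinner (ell2_push f x) (ell2_push f y) = cinner x y"
    by (simp add: cinner_ell2_def o_def ell2_nth_push_image[OF assms])
qed

lemma ell2_push_comp:
  assumes "inj f" "inj g"
  shows "ell2_push f (ell2_push g x) = ell2_push (f \<circ> g) x"
proof (rule ell2_eqI)
  fix b
  have fg: "inj (f \<circ> g)" using assms by (rule inj_compose)
  show "ell2_nth (ell2_push f (ell2_push g x)) b = ell2_nth (ell2_push (f \<circ> g) x) b"
  proof (cases "b \<in> range f")
    case True
    then obtain a where a: "b = f a" by blast
    show ?thesis
    proof (cases "a \<in> range g")
      case True
      then obtain i where "a = g i" by blast
      then show ?thesis
        using ell2_nth_push_image[OF fg, of x i] by (simp add: a assms ell2_nth_push_image)
    next
      case False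
      then have "b \<notin> range (f \<circ> g)" using a assms by (auto dest: injD)
      then show ?thesis using False
        by (simp add: ell2_nth_push[OF fg] a ell2_nth_push_image ell2_nth_push assms)
    qed
  next
    case False
    then have "b \<notin> range (f \<circ> g)" by auto
    then show ?thesis using False
      by (simp only: ell2_nth_push[OF fg] ell2_nth_push[OF assms(1)] if_False)
  qed
qed

lemma ell2_push_id: "ell2_push id x = x"
  by (rule ell2_eqI) (simp add: ell2_nth_push)

lemma cinner_ell2_push_disjoint:
  assumes "inj f" "inj g" "range f \<inter> range g = {}"
  shows "cinner (ell2_push f x) (ell2_push g y) = 0"
proof -
  have "ell2_nth (ell2_push f x) b * cnj (ell2_nth (ell2_push g y) b) = 0" for b
    using assms by (auto simp: ell2_nth_push)
  then show ?thesis by (simp only: cinner_ell2_def infsum_0)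
qed

lemma ell2_push_unitary:
  assumes "bij f"
  shows "unitary (ell2_push f)"
proof -
  have "inj f" "inj (inv f)" "f \<circ> inv f = id"
    using assms by (auto simp: bij_is_inj bij_imp_bij_inv bij_is_surj surj_iff[symmetric])
  then have "ell2_push f (ell2_push (inv f) x) = x" for x
    by (simp add: ell2_push_comp ell2_push_id)
  then have "surj (ell2_push f)" by (metis surjI)
  then show ?thesis
    using ell2_push_isometric[OF \<open>inj f\<close>] by (simp add: unitary_def)
qed

text \<open>
  The permutation of the image of \<open>f\<close> that corresponds to \<open>g\<close>, continued by the identity.
\<close>

definition transport :: "('a \<Rightarrow> 'b) \<Rightarrow> ('a \<Rightarrow> 'a) \<Rightarrow> 'b \<Rightarrow> 'b" where
  "transport f g b = (if b \<in> range f then f (g (inv f b)) else b)"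

lemma transport_image: "inj f \<Longrightarrow> transport f g (f a) = f (g a)"
  by (simp add: transport_def)

lemma transport_comp:
  assumes "inj f"
  shows "transport f g \<circ> transport f h = transport f (g \<circ> h)"
  using assms by (auto simp: transport_def fun_eq_iff)

lemma transport_bij:
  assumes "inj f" "bij g"
  shows "bij (transport f g)"
proof (rule o_bij)
  have id: "transport f id = id" by (auto simp: transport_def fun_eq_iff f_inv_into_f)
  have "inv g \<circ> g = id" "g \<circ> inv g = id"
    using assms by (auto simp: bij_is_inj bij_is_surj surj_iff[symmetric])
  then show "transport f (inv g) \<circ> transport f g = id" "transport f g \<circ> transport f (inv g) = id"
    by (simp_all add: transport_comp[OF assms(1)] id)
qed

section \<open>Multi-indices and monomials of commuting operators\<close>

lemma multi_index_induct [case_names zero add_single]: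
  fixes I :: "'d::finite multi_index"
  assumes zero: "P 0" and step: "\<And>I j. P I \<Longrightarrow> P (I + Poly_Mapping.single j 1)"
  shows "P I"
proof (induction "\<Sum>j\<in>UNIV. Poly_Mapping.lookup I j" arbitrary: I)
  case 0
  then have "I = 0" by (intro poly_mapping_eqI) simp
  then show ?case using zero by simp
next
  case (Suc n)
  then obtain k where k: "Poly_Mapping.lookup I k \<noteq> 0"
    by (metis (mono_tags, lifting) Zero_not_Suc sum.neutral)
  let ?J = "I - Poly_Mapping.single k 1"
  have I: "I = ?J + Poly_Mapping.single k 1"
    using k by (intro poly_mapping_eqI) (auto simp: lookup_add lookup_minus lookup_single when_def)
  have "Poly_Mapping.lookup I j = Poly_Mapping.lookup ?J j + (1 when k = j)" for j
    using k by (cases "k = j") (simp_all add: lookup_minus lookup_single)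
  then have "(\<Sum>j\<in>UNIV. Poly_Mapping.lookup I j)
      = (\<Sum>j\<in>UNIV. Poly_Mapping.lookup ?J j) + (\<Sum>j\<in>UNIV. 1 when k = j)"
    by (simp only: sum.distrib)
  then have "n = (\<Sum>j\<in>UNIV. Poly_Mapping.lookup ?J j)"
    using Suc.hyps(2) by (simp add: when_def)
  then have "P ?J" by (rule Suc.hyps(1))
  then show ?case using step[of ?J k] I by simp
qed

lemma lookup_surj: "\<exists>I :: 'd::finite multi_index. Poly_Mapping.lookup I = f"
  by (rule exI[of _ "Abs_poly_mapping f"]) simp

lemma op_monomial_add:
  assumes "commuting T"
  shows "op_monomial T (I + J) = op_monomial T I \<circ> op_monomial T J"
proof (induction I rule: multi_index_induct)
  case (add_single I j)
  have "op_monomial T (I + Poly_Mapping.single j 1 + J) = T j \<circ> op_monomial T (I + J)"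
    by (simp only: add.assoc add.commute[of _ J] op_monomial_add_single[OF assms, symmetric])
  then show ?case
    by (simp only: add_single.IH op_monomial_add_single[OF assms] comp_assoc)
qed (simp add: op_monomial_zero)

text \<open>
  Induction over the monomial, for properties of operators that are stable under composition with
  the \<open>T j\<close>.
\<close>

lemma op_monomial_invariant:
  assumes "commuting T" and "P id" and "\<And>j f. P f \<Longrightarrow> P (T j \<circ> f)"
  shows "P (op_monomial T I)"
  by (induction I rule: multi_index_induct)
     (simp_all only: op_monomial_zero op_monomial_add_single[OF assms(1)] assms(2,3))

lemma isometric_op_monomial:
  assumes "commuting U" "\<And>j. isometric (U j)"
  shows "isometric (op_monomial U I)"
proof (rule op_monomial_invariant[OF assms(1)])
  show "isometric (U j \<circ> f)" if "isometric f" for j f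
    using that assms(2)[of j] by (simp add: isometric_def clinear_iff)
qed (simp add: isometric_def clinear_iff)

section \<open>Von Neumann's inequality for commuting isometries\<close>

text \<open>
  The exponents \<open>{0..<M}\<^sup>d\<close>; they also number the points of the torus all of whose coordinates are
  \<open>M\<close>-th roots of unity, by \<open>torus_point\<close>.
\<close>

definition torus_grid :: "nat \<Rightarrow> ('d::finite \<Rightarrow> nat) set" where
  "torus_grid M = PiE UNIV (\<lambda>_. {..<M})"

definition torus_point :: "nat \<Rightarrow> ('d::finite \<Rightarrow> nat) \<Rightarrow> 'd \<Rightarrow> complex" where
  "torus_point M k j = cis (2 * pi * real (k j) / real M)"

definition power_product :: "('d::finite \<Rightarrow> complex) \<Rightarrow> ('d \<Rightarrow> nat) \<Rightarrow> complex" where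
  "power_product z r = (\<Prod>j\<in>UNIV. z j ^ r j)"

lemma torus_grid_iff: "r \<in> torus_grid M \<longleftrightarrow> (\<forall>j. r j < M)"
  by (auto simp: torus_grid_def PiE_def)

lemma finite_torus_grid: "finite (torus_grid M :: ('d::finite \<Rightarrow> nat) set)"
  unfolding torus_grid_def by (rule finite_PiE) auto

lemma power_product_add: "power_product z (\<lambda>j. r j + s j) = power_product z r * power_product z s"
  by (simp add: power_product_def power_add prod.distrib)

lemma sum_roots_of_unity_orthogonal:
  assumes "a < M" "b < M"
  shows "(\<Sum>k<M. cis (2 * pi * real k / real M) ^ a * cnj (cis (2 * pi * real k / real M) ^ b))
      = (if a = b then of_nat M else 0)"
proof -
  define \<omega> where "\<omega> a = cis (2 * pi * real a / real M)" for a
  have "M > 0" using assms by simp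
  have swap: "cis (2 * pi * real k / real M) ^ a = \<omega> a ^ k" for k a
    unfolding \<omega>_def Complex.DeMoivre by (rule arg_cong[where f = cis]) (simp add: mult_ac)
  define q where "q = \<omega> a * cnj (\<omega> b)"
  have unit: "\<omega> b * cnj (\<omega> b) = 1"
    by (simp add: \<omega>_def cis_cnj cis_mult)
  have "(\<Sum>k<M. cis (2 * pi * real k / real M) ^ a * cnj (cis (2 * pi * real k / real M) ^ b))
      = (\<Sum>k<M. q ^ k)"
    by (simp only: swap q_def power_mult_distrib complex_cnj_power)
  also have "\<dots> = (if a = b then of_nat M else 0)"
  proof (cases "a = b")
    case True
    then show ?thesis by (simp add: q_def unit)
  next
    case False
    have "q \<noteq> 1"
    proof
      assume "q = 1"
      then have "q * \<omega> b = \<omega> b" by simp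
      then have "\<omega> a = \<omega> b" using unit by (simp add: q_def mult.commute mult.left_commute)
      moreover have "inj_on \<omega> {..<M}"
        unfolding \<omega>_def using Complex.bij_betw_roots_unity[OF \<open>M > 0\<close>] by (rule bij_betw_imp_inj_on)
      ultimately show False using False assms by (auto dest: inj_onD)
    qed
    have "\<omega> c ^ M = 1" for c
      using \<open>M > 0\<close> by (simp add: \<omega>_def Complex.DeMoivre cis_multiple_2pi)
    then have "q ^ M = 1"
      by (simp add: q_def power_mult_distrib flip: complex_cnj_power)
    then show ?thesis using \<open>q \<noteq> 1\<close> False geometric_sum[OF \<open>q \<noteq> 1\<close>, of M] by simp
  qed
  finally show ?thesis .
qed

text \<open>
  The sum factorises into one sum over \<open>M\<close>-th roots of unity for each coordinate.
\<close>

lemma sum_characters_orthogonal: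
  fixes r s :: "'d::finite \<Rightarrow> nat"
  assumes "r \<in> torus_grid M" "s \<in> torus_grid M"
  shows "(\<Sum>k\<in>torus_grid M. power_product (torus_point M k) r * cnj (power_product (torus_point M k) s))
      = (if r = s then of_nat (M ^ CARD('d)) else 0)"
proof -
  let ?c = "\<lambda>j i. cis (2 * pi * real i / real M) ^ r j * cnj (cis (2 * pi * real i / real M) ^ s j)"
  have "(\<Sum>k\<in>torus_grid M. power_product (torus_point M k) r * cnj (power_product (torus_point M k) s))
      = (\<Sum>k\<in>PiE UNIV (\<lambda>_. {..<M}). \<Prod>j\<in>UNIV. ?c j (k j))"
    by (simp add: torus_grid_def power_product_def torus_point_def prod.distrib)
  also have "\<dots> = (\<Prod>j\<in>UNIV. \<Sum>i<M. ?c j i)"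
    by (rule prod_sum_PiE[symmetric]) auto
  also have "\<dots> = (\<Prod>j\<in>UNIV. if r j = s j then of_nat M else 0)"
    by (rule prod.cong) (use assms in \<open>simp_all only: sum_roots_of_unity_orthogonal torus_grid_iff\<close>)
  also have "\<dots> = (if r = s then of_nat (M ^ CARD('d)) else 0)"
    by (auto simp: fun_eq_iff prod_zero_iff)
  finally show ?thesis .
qed

text \<open>
  Parseval's identity for vector-valued trigonometric polynomials: as the exponents \<open>\<phi> p\<close> are
  distinct modulo \<open>M\<close>, all mixed terms average to zero.
\<close>

lemma parseval_torus_grid:
  fixes a :: "'p \<Rightarrow> 'a::complex_inner" and \<phi> :: "'p \<Rightarrow> 'd::finite \<Rightarrow> nat"
  assumes "finite P" and inj: "inj_on \<phi> P" and range: "\<And>p. p \<in> P \<Longrightarrow> \<phi> p \<in> torus_grid M"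
  shows "(\<Sum>k\<in>torus_grid M. (norm (\<Sum>p\<in>P. power_product (torus_point M k) (\<phi> p) *\<^sub>C a p))\<^sup>2)
      = real (M ^ CARD('d)) * (\<Sum>p\<in>P. (norm (a p))\<^sup>2)"
proof -
  let ?\<xi> = "\<lambda>k p. power_product (torus_point M k) (\<phi> p)"
  have "complex_of_real (\<Sum>k\<in>torus_grid M. (norm (\<Sum>p\<in>P. ?\<xi> k p *\<^sub>C a p))\<^sup>2)
      = (\<Sum>k\<in>torus_grid M. \<Sum>p\<in>P. \<Sum>q\<in>P. ?\<xi> k p * cnj (?\<xi> k q) * cinner (a p) (a q))"
    unfolding of_real_sum cinner_self[symmetric]
    by (simp only: cinner_sum_left, simp only: cinner_sum_right)
       (simp add: cinner_scaleC_left cinner_scaleC_right mult_ac)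
  also have "\<dots> = (\<Sum>p\<in>P. \<Sum>k\<in>torus_grid M. \<Sum>q\<in>P. ?\<xi> k p * cnj (?\<xi> k q) * cinner (a p) (a q))"
    by (rule sum.swap)
  also have "\<dots> = (\<Sum>p\<in>P. \<Sum>q\<in>P. \<Sum>k\<in>torus_grid M. ?\<xi> k p * cnj (?\<xi> k q) * cinner (a p) (a q))"
    by (rule sum.cong[OF refl], rule sum.swap)
  also have "\<dots> = (\<Sum>p\<in>P. \<Sum>q\<in>P. if p = q then of_nat (M ^ CARD('d)) * cinner (a p) (a p) else 0)"
  proof (intro sum.cong refl)
    fix p q assume "p \<in> P" "q \<in> P"
    then show "(\<Sum>k\<in>torus_grid M. ?\<xi> k p * cnj (?\<xi> k q) * cinner (a p) (a q))
        = (if p = q then of_nat (M ^ CARD('d)) * cinner (a p) (a p) else 0)"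
      unfolding sum_distrib_right[symmetric]
      using sum_characters_orthogonal[OF range range, of p q] inj_onD[OF inj, of p q] by auto
  qed
  also have "\<dots> = complex_of_real (real (M ^ CARD('d)) * (\<Sum>p\<in>P. (norm (a p))\<^sup>2))"
    using \<open>finite P\<close> by (simp add: cinner_self sum_distrib_left)
  finally show ?thesis by (simp only: of_real_eq_iff)
qed

lemma eval_poly_bounded:
  fixes p :: "'d::finite polynomial"
  shows "bdd_above ((\<lambda>z. cmod (eval_poly p z)) ` {z. \<forall>j. cmod (z j) \<le> 1})"
proof (rule bdd_aboveI2)
  fix z :: "'d \<Rightarrow> complex" assume "z \<in> {z. \<forall>j. cmod (z j) \<le> 1}"
  then have z: "cmod (z j) \<le> 1" for j by simp
  have "cmod (eval_poly p z) \<le> (\<Sum>I\<in>Poly_Mapping.keys p.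
      cmod (Poly_Mapping.lookup p I * (\<Prod>j\<in>UNIV. z j ^ Poly_Mapping.lookup I j)))"
    unfolding eval_poly_def by (rule norm_sum)
  also have "\<dots> \<le> (\<Sum>I\<in>Poly_Mapping.keys p. cmod (Poly_Mapping.lookup p I) * 1)"
    unfolding norm_mult
    by (intro sum_mono mult_left_mono)
       (auto simp: prod_norm[symmetric] norm_power z intro!: prod_le_1 power_le_one)
  finally show "cmod (eval_poly p z) \<le> (\<Sum>I\<in>Poly_Mapping.keys p. cmod (Poly_Mapping.lookup p I) * 1)" .
qed

definition index_box :: "nat \<Rightarrow> 'd::finite multi_index set" where
  "index_box N = {I. \<forall>j. Poly_Mapping.lookup I j < N}"

lemma index_box_bij: "bij_betw Poly_Mapping.lookup (index_box N) (torus_grid N)"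
proof (rule bij_betw_imageI)
  show "inj_on Poly_Mapping.lookup (index_box N)" by (auto intro: inj_onI poly_mapping_eqI)
  show "Poly_Mapping.lookup ` index_box N = torus_grid N"
  proof
    show "torus_grid N \<subseteq> Poly_Mapping.lookup ` index_box N"
    proof
      fix f assume "f \<in> torus_grid N"
      moreover obtain I where I: "f = Poly_Mapping.lookup I" using lookup_surj[of f] by blast
      ultimately have "I \<in> index_box N" by (simp add: torus_grid_iff index_box_def)
      with I show "f \<in> Poly_Mapping.lookup ` index_box N" by (rule image_eqI)
    qed
  qed (auto simp: torus_grid_iff index_box_def)
qed

lemma finite_index_box: "finite (index_box N)"
  using bij_betw_finite[OF index_box_bij] finite_torus_grid by blast

lemma card_index_box: "card (index_box N :: 'd::finite multi_index set) = N ^ CARD('d)"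
  using bij_betw_same_card[OF index_box_bij, of N] by (simp add: torus_grid_def card_PiE)

text \<open>
  Let \<open>F z = \<Sum>\<^bsub>n\<^esub> z\<^bsup>N - n\<^esup> U\<^sup>n x\<close>, summed over the box of side \<open>N = L + D\<close>, where \<open>D\<close> bounds
  the degrees in \<open>p\<close>.  The coefficient of \<open>z\<^bsup>N - m\<^esup>\<close> in \<open>p(z) F z\<close> is the sum of \<open>p\<^sub>K U\<^sup>n x\<close> over
  \<open>n = m + K\<close>; for \<open>m\<close> in the box of side \<open>L\<close> all these \<open>n\<close> lie in the large box, and the coefficient
  is exactly \<open>U\<^sup>m p(U) x\<close>, of norm \<open>\<parallel>p(U) x\<parallel>\<close>.  By Parseval the mean of \<open>\<parallel>p(z) F z\<parallel>\<^sup>2\<close> is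
  at least \<open>L\<^sup>d \<parallel>p(U) x\<parallel>\<^sup>2\<close>, while it is at most \<open>S\<^sup>2\<close> times the mean of \<open>\<parallel>F z\<parallel>\<^sup>2\<close>, which is
  \<open>N\<^sup>d \<parallel>x\<parallel>\<^sup>2\<close>.
\<close>

lemma isometries_box_estimate:
  fixes U :: "'d::finite \<Rightarrow> 'a \<Rightarrow> 'a::complex_inner"
  assumes U: "commuting U" "\<And>j. isometric (U j)"
    and S: "\<And>z. (\<And>j. cmod (z j) \<le> 1) \<Longrightarrow> cmod (eval_poly p z) \<le> S"
    and D: "\<And>K j. K \<in> Poly_Mapping.keys p \<Longrightarrow> Poly_Mapping.lookup K j \<le> D"
  shows "real (L ^ CARD('d)) * (norm (op_poly p U x))\<^sup>2
      \<le> real ((L + D) ^ CARD('d)) * (S\<^sup>2 * (norm x)\<^sup>2)"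
proof -
  define N where "N = L + D"
  \<comment> \<open>All exponents of \<open>p(z) F z\<close> are at most \<open>N + D\<close>, so none coincide modulo \<open>M\<close>.\<close>
  define M where "M = N + D + 1"
  define G :: "('d \<Rightarrow> nat) set" where "G = torus_grid M"
  define mon where "mon I = op_monomial U I x" for I
  define \<xi> where "\<xi> k r = power_product (torus_point M k) r" for k :: "'d \<Rightarrow> nat" and r
  \<comment> \<open>Reflecting the exponents keeps them natural numbers; the factor \<open>z\<^sup>N\<close> does not change norms.\<close>
  define flip :: "'d multi_index \<Rightarrow> 'd \<Rightarrow> nat" where "flip I = (\<lambda>j. N - Poly_Mapping.lookup I j)" for I
  define F where "F k = (\<Sum>n\<in>index_box N. \<xi> k (flip n) *\<^sub>C mon n)" for k
  \<comment> \<open>The term of \<open>p(z) F z\<close> that comes from \<open>K\<close> in \<open>p\<close> and \<open>n\<close> in \<open>F\<close> has exponent \<open>\<psi> (K, n)\<close>.\<close>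
  define \<psi> :: "'d multi_index \<times> 'd multi_index \<Rightarrow> 'd \<Rightarrow> nat" where
    "\<psi> = (\<lambda>(K, n) j. Poly_Mapping.lookup K j + flip n j)"
  define trm where "trm = (\<lambda>(K, n). Poly_Mapping.lookup p K *\<^sub>C mon n)"
  let ?Q = "Poly_Mapping.keys p \<times> index_box N"
  define a where "a r = (\<Sum>q\<in>{q \<in> ?Q. \<psi> q = r}. trm q)" for r
  have iso: "isometric (op_monomial U I)" for I
    using isometric_op_monomial[OF U] .
  have flip_inj: "inj_on flip (index_box (N + 1))"
  proof (rule inj_onI, rule poly_mapping_eqI)
    fix I J j assume IJ: "I \<in> index_box (N + 1)" "J \<in> index_box (N + 1)" "flip I = flip J"
    have "Poly_Mapping.lookup I j \<le> N" "Poly_Mapping.lookup J j \<le> N"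
      using IJ by (auto simp: index_box_def less_Suc_eq_le)
    moreover have "N - Poly_Mapping.lookup I j = N - Poly_Mapping.lookup J j"
      using fun_cong[OF IJ(3), of j] by (simp add: flip_def)
    ultimately show "Poly_Mapping.lookup I j = Poly_Mapping.lookup J j" by linarith
  qed
  have box_mono: "index_box m \<subseteq> index_box n" if "m \<le> n" for m n
    using that by (auto simp: index_box_def intro: less_le_trans)
  have finQ: "finite ?Q" by (simp add: finite_index_box)
  have \<psi>G: "\<psi> q \<in> G" if "q \<in> ?Q" for q
    using that D by (auto simp: \<psi>_def flip_def G_def M_def torus_grid_iff
        intro!: le_imp_less_Suc add_mono diff_le_self simp: add.commute[of N])
  have F: "(\<Sum>k\<in>G. (norm (F k))\<^sup>2) = real (M ^ CARD('d)) * (real (N ^ CARD('d)) * (norm x)\<^sup>2)"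
  proof -
    have "(\<Sum>k\<in>G. (norm (F k))\<^sup>2) = real (M ^ CARD('d)) * (\<Sum>n\<in>index_box N. (norm (mon n))\<^sup>2)"
      unfolding G_def F_def \<xi>_def
    proof (rule parseval_torus_grid)
      show "inj_on flip (index_box N)" using flip_inj box_mono[of N "N + 1"] by (auto intro: inj_on_subset)
    qed (auto simp: finite_index_box flip_def torus_grid_iff M_def)
    also have "(\<Sum>n\<in>index_box N. (norm (mon n))\<^sup>2) = real (N ^ CARD('d)) * (norm x)\<^sup>2"
      by (simp add: mon_def isometric_norm[OF iso] card_index_box)
    finally show ?thesis .
  qed
  have pF: "eval_poly p (torus_point M k) *\<^sub>C F k = (\<Sum>r\<in>G. \<xi> k r *\<^sub>C a r)" for k
  proof -
    have poly: "eval_poly p (torus_point M k)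
        = (\<Sum>K\<in>Poly_Mapping.keys p. Poly_Mapping.lookup p K * \<xi> k (Poly_Mapping.lookup K))"
      by (simp add: eval_poly_def \<xi>_def power_product_def)
    have "eval_poly p (torus_point M k) *\<^sub>C F k = (\<Sum>K\<in>Poly_Mapping.keys p. \<Sum>n\<in>index_box N.
        (Poly_Mapping.lookup p K * \<xi> k (Poly_Mapping.lookup K)) *\<^sub>C \<xi> k (flip n) *\<^sub>C mon n)"
      by (simp only: poly F_def complex_vector.scale_sum_left) (simp only: complex_vector.scale_sum_right)
    also have "\<dots> = (\<Sum>q\<in>?Q. \<xi> k (\<psi> q) *\<^sub>C trm q)"
      unfolding sum.cartesian_product
      by (rule sum.cong) (auto simp: \<psi>_def trm_def \<xi>_def power_product_add scaleC_scaleC mult_ac)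
    also have "\<dots> = (\<Sum>r\<in>G. \<Sum>q\<in>{q \<in> ?Q. \<psi> q = r}. \<xi> k (\<psi> q) *\<^sub>C trm q)"
      by (rule sum.group[symmetric]) (use finQ \<psi>G finite_torus_grid in \<open>auto simp: G_def\<close>)
    also have "\<dots> = (\<Sum>r\<in>G. \<xi> k r *\<^sub>C a r)"
      by (rule sum.cong[OF refl]) (simp add: a_def complex_vector.scale_sum_right)
    finally show ?thesis .
  qed
  have a: "a (flip m) = op_monomial U m (op_poly p U x)" if m: "m \<in> index_box L" for m
  proof -
    have "{q \<in> ?Q. \<psi> q = flip m} = (\<lambda>K. (K, m + K)) ` Poly_Mapping.keys p"
    proof (intro equalityI subsetI)
      fix q assume "q \<in> {q \<in> ?Q. \<psi> q = flip m}"
      then obtain K n where q: "q = (K, n)" "K \<in> Poly_Mapping.keys p" "n \<in> index_box N" "\<psi> (K, n) = flip m"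
        by auto
      have "n = m + K"
      proof (rule poly_mapping_eqI)
        fix j
        have "Poly_Mapping.lookup n j < N" using q by (simp add: index_box_def)
        moreover have "Poly_Mapping.lookup m j < N" using m by (simp add: index_box_def N_def trans_less_add1)
        moreover have "Poly_Mapping.lookup K j + (N - Poly_Mapping.lookup n j) = N - Poly_Mapping.lookup m j"
          using fun_cong[OF q(4), of j] by (simp add: \<psi>_def flip_def)
        ultimately show "Poly_Mapping.lookup n j = Poly_Mapping.lookup (m + K) j"
          unfolding lookup_add by linarith
      qed
      then show "q \<in> (\<lambda>K. (K, m + K)) ` Poly_Mapping.keys p" using q by blast
    next
      fix q assume "q \<in> (\<lambda>K. (K, m + K)) ` Poly_Mapping.keys p"
      then obtain K where q: "q = (K, m + K)" "K \<in> Poly_Mapping.keys p" by blast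
      have lt: "Poly_Mapping.lookup m j + Poly_Mapping.lookup K j < N" for j
        using m D[OF q(2), of j] by (auto simp: index_box_def N_def intro: add_less_le_mono)
      have "Poly_Mapping.lookup K j + (N - (Poly_Mapping.lookup m j + Poly_Mapping.lookup K j))
          = N - Poly_Mapping.lookup m j" for j
        using lt[of j] by linarith
      then show "q \<in> {q \<in> ?Q. \<psi> q = flip m}"
        using q lt by (auto simp: index_box_def \<psi>_def flip_def lookup_add)
    qed
    then have "a (flip m) = (\<Sum>K\<in>Poly_Mapping.keys p. Poly_Mapping.lookup p K *\<^sub>C op_monomial U (m + K) x)"
      unfolding a_def by (simp add: sum.reindex inj_on_def trm_def mon_def)
    also have "\<dots> = op_monomial U m (op_poly p U x)"
      using iso[of m] by (simp add: op_poly_def clinear_sum isometric_def clinear_iff op_monomial_add[OF U(1)])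
    finally show ?thesis .
  qed
  have "real (M ^ CARD('d)) * (real (L ^ CARD('d)) * (norm (op_poly p U x))\<^sup>2)
      = real (M ^ CARD('d)) * (\<Sum>m\<in>index_box L. (norm (a (flip m)))\<^sup>2)"
    by (simp add: a isometric_norm[OF iso] card_index_box)
  also have "(\<Sum>m\<in>index_box L. (norm (a (flip m)))\<^sup>2) = (\<Sum>r\<in>flip ` index_box L. (norm (a r))\<^sup>2)"
    using inj_on_subset[OF flip_inj box_mono[of L "N + 1"]] by (simp add: sum.reindex N_def)
  also have "\<dots> \<le> (\<Sum>r\<in>G. (norm (a r))\<^sup>2)"
    by (rule sum_mono2) (auto simp: G_def finite_torus_grid flip_def torus_grid_iff M_def)
  also have "real (M ^ CARD('d)) * (\<Sum>r\<in>G. (norm (a r))\<^sup>2)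
      = (\<Sum>k\<in>G. (norm (\<Sum>r\<in>G. \<xi> k r *\<^sub>C a r))\<^sup>2)"
    using parseval_torus_grid[of G "\<lambda>r. r" M a] by (simp add: G_def finite_torus_grid \<xi>_def)
  also have "\<dots> = (\<Sum>k\<in>G. (cmod (eval_poly p (torus_point M k)))\<^sup>2 * (norm (F k))\<^sup>2)"
    by (simp add: norm_scaleC power_mult_distrib flip: pF)
  also have "\<dots> \<le> (\<Sum>k\<in>G. S\<^sup>2 * (norm (F k))\<^sup>2)"
    by (intro sum_mono mult_right_mono power_mono S) (auto simp: torus_point_def)
  also have "\<dots> = real (M ^ CARD('d)) * (real (N ^ CARD('d)) * (S\<^sup>2 * (norm x)\<^sup>2))"
    by (simp add: F mult_ac flip: sum_distrib_left)
  finally have "real (M ^ CARD('d)) * (real (L ^ CARD('d)) * (norm (op_poly p U x))\<^sup>2)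
      \<le> real (M ^ CARD('d)) * (real (N ^ CARD('d)) * (S\<^sup>2 * (norm x)\<^sup>2))"
    by (simp add: mult_left_mono)
  then show ?thesis
    by (simp add: M_def N_def mult_le_cancel_left_pos)
qed

text \<open>
  Letting \<open>L\<close> tend to infinity in the box estimate, \<open>((L + D) / L)\<^sup>d\<close> tends to \<open>1\<close>.
\<close>

theorem von_neumann_commuting_isometries:
  fixes U :: "'d::finite \<Rightarrow> 'a \<Rightarrow> 'a::complex_inner"
  assumes U: "commuting U" "\<And>j. isometric (U j)"
  shows "norm (op_poly p U x) \<le> (SUP z\<in>{z. \<forall>j. cmod (z j) \<le> 1}. cmod (eval_poly p z)) * norm x"
proof -
  define S where "S = (SUP z\<in>{z. \<forall>j. cmod (z j) \<le> 1}. cmod (eval_poly p z))"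
  have S: "cmod (eval_poly p z) \<le> S" if "\<And>j. cmod (z j) \<le> 1" for z
    unfolding S_def by (rule cSUP_upper[OF _ eval_poly_bounded]) (use that in simp)
  have "0 \<le> S" using order_trans[OF norm_ge_zero S[of "\<lambda>_. 0"]] by simp
  define D where "D = Max ((\<lambda>(K, j). Poly_Mapping.lookup K j) ` (Poly_Mapping.keys p \<times> (UNIV :: 'd set)))"
  have D: "Poly_Mapping.lookup K j \<le> D" if "K \<in> Poly_Mapping.keys p" for K j
  proof -
    have "(\<lambda>(K, j). Poly_Mapping.lookup K j) (K, j)
        \<in> (\<lambda>(K, j). Poly_Mapping.lookup K j) ` (Poly_Mapping.keys p \<times> (UNIV :: 'd set))"
      by (rule imageI) (use that in simp)
    then show ?thesis
      unfolding D_def by (intro Max_ge) simp_all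
  qed
  define c where "c = (norm (op_poly p U x))\<^sup>2"
  define s where "s = S\<^sup>2 * (norm x)\<^sup>2"
  have "c \<le> s"
  proof (rule LIMSEQ_le_const)
    have "(\<lambda>L. 1 + real D * inverse (real (Suc L))) \<longlonglongrightarrow> 1 + real D * 0"
      by (rule tendsto_add[OF tendsto_const tendsto_mult[OF tendsto_const LIMSEQ_inverse_real_of_nat]])
    from tendsto_mult[OF tendsto_power[OF this, of "CARD('d)"] tendsto_const[of s]]
    show "(\<lambda>L. (1 + real D * inverse (real (Suc L))) ^ CARD('d) * s) \<longlonglongrightarrow> s" by simp
    have "c \<le> (1 + real D * inverse (real (Suc L))) ^ CARD('d) * s" for L
    proof -
      have "real (Suc L) ^ CARD('d) * c \<le> real (Suc L + D) ^ CARD('d) * s"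
        using isometries_box_estimate[OF U S D, of "Suc L" x]
        by (simp only: c_def s_def of_nat_power)
      also have "real (Suc L + D) = real (Suc L) * (1 + real D * inverse (real (Suc L)))"
        by (simp add: distrib_left)
      finally show ?thesis
        unfolding power_mult_distrib mult.assoc
        by (rule mult_left_le_imp_le) simp
    qed
    then show "\<exists>N. \<forall>L\<ge>N. c \<le> (1 + real D * inverse (real (Suc L))) ^ CARD('d) * s"
      by (intro exI allI impI)
  qed
  then have "(norm (op_poly p U x))\<^sup>2 \<le> (S * norm x)\<^sup>2"
    by (simp only: c_def s_def power_mult_distrib)
  moreover have "0 \<le> S * norm x"
    using \<open>0 \<le> S\<close> by simp
  ultimately show ?thesis
    unfolding S_def[symmetric] by (rule power2_le_imp_le)
qed

section \<open>Contractive weighted shifts\<close>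

lemma bounded_operator_op_monomial:
  assumes "commuting T" "\<And>j. bounded_operator (T j)"
  shows "bounded_operator (op_monomial T I)"
proof (rule op_monomial_invariant[OF assms(1)])
  show "bounded_operator id"
    by (simp add: bounded_operator_def clinear_iff bounded_linear_ident id_def)
  show "bounded_operator (T j \<circ> f)" if "bounded_operator f" for j f
    using that assms(2)[of j] bounded_linear_compose[of "T j" f]
    by (simp add: bounded_operator_def clinear_iff o_def)
qed

text \<open>
  The matrix coefficients of all monomials determine the compression of \<open>p(U)\<close>, by density first in
  the second and then in the first argument of the inner product.
\<close>

lemma weak_dilation_from_basis:
  fixes T :: "'d::finite \<Rightarrow> 'h::chilbert_space \<Rightarrow> 'h" and V :: "'h \<Rightarrow> 'k::chilbert_space"
  assumes e: "orthonormal_basis e" and T: "commuting T" "\<And>j. bounded_operator (T j)"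
    and V: "isometric V" and U: "\<And>j. isometric (U j)" "commuting U"
    and moments: "\<And>K I J. cinner (op_monomial U K (V (e I))) (V (e J)) = cinner (op_monomial T K (e I)) (e J)"
  shows "cinner (op_poly p U (V h)) (V k) = cinner (op_poly p T h) k"
proof -
  have Vlin: "V (x + y) = V x + V y" "V (c *\<^sub>C x) = c *\<^sub>C V x" "V 0 = 0" for x y c
    using V clinear_zero[of V] by (simp_all add: isometric_def clinear_iff)
  have Vcont: "continuous_on UNIV V"
    by (rule linear_continuous_on) (rule isometric_bounded_linear[OF V])
  have UK: "isometric (op_monomial U K)" for K
    using U by (intro isometric_op_monomial) auto
  have Ulin: "op_monomial U K (x + y) = op_monomial U K x + op_monomial U K y"
    "op_monomial U K (c *\<^sub>C x) = c *\<^sub>C op_monomial U K x" "op_monomial U K 0 = 0" for K x y c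
    using UK[of K] clinear_zero[of "op_monomial U K"] by (simp_all add: isometric_def clinear_iff)
  have TK: "bounded_operator (op_monomial T K)" for K
    using T by (rule bounded_operator_op_monomial)
  have Tlin: "op_monomial T K (x + y) = op_monomial T K x + op_monomial T K y"
    "op_monomial T K (c *\<^sub>C x) = c *\<^sub>C op_monomial T K x" "op_monomial T K 0 = 0" for K x y c
    using TK[of K] clinear_zero[of "op_monomial T K"] by (simp_all add: bounded_operator_def clinear_iff)
  have Tcont: "continuous_on UNIV (op_monomial T K)" for K
    by (rule linear_continuous_on) (use TK[of K] in \<open>simp add: bounded_operator_def\<close>)
  have UVcont: "continuous_on UNIV (\<lambda>h. op_monomial U K (V h))" for K
    using bounded_linear_compose[OF isometric_bounded_linear[OF UK] isometric_bounded_linear[OF V]]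
    by (rule linear_continuous_on)
  have 1: "cinner (op_monomial U K (V (e I))) (V k) = cinner (op_monomial T K (e I)) k" for K I k
  proof (rule orthonormal_basis_density[OF e,
        where P = "\<lambda>k. cinner (op_monomial U K (V (e I))) (V k) = cinner (op_monomial T K (e I)) k"])
    show "closed {k. cinner (op_monomial U K (V (e I))) (V k) = cinner (op_monomial T K (e I)) k}"
      by (intro closed_Collect_eq continuous_on_cinner Vcont continuous_on_const continuous_on_id)
  qed (simp_all add: moments complex_vector.subspace_def Vlin cinner_add_right cinner_scaleC_right)
  have 2: "cinner (op_monomial U K (V h)) (V k) = cinner (op_monomial T K h) k" for K h k
  proof (rule orthonormal_basis_density[OF e,
        where P = "\<lambda>h. cinner (op_monomial U K (V h)) (V k) = cinner (op_monomial T K h) k"])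
    show "closed {h. cinner (op_monomial U K (V h)) (V k) = cinner (op_monomial T K h) k}"
      by (intro closed_Collect_eq continuous_on_cinner UVcont Tcont continuous_on_const)
  qed (simp_all add: 1 complex_vector.subspace_def Vlin Ulin Tlin cinner_add_left cinner_scaleC_left)
  then show ?thesis
    by (simp add: op_poly_def cinner_sum_left cinner_scaleC_left)
qed

lemma unitary_dilationI:
  fixes T :: "'d::finite \<Rightarrow> 'h::chilbert_space \<Rightarrow> 'h" and V :: "'h \<Rightarrow> 'k::chilbert_space"
  assumes V: "isometric V" and U: "\<And>j. unitary (U j)" "commuting U"
    and weak: "\<And>p h k. cinner (op_poly p U (V h)) (V k) = cinner (op_poly p T h) k"
  shows "unitary_dilation T V U"
proof -
  have Vdiff: "V (x - y) = V x - V y" for x y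
    using V clinear_diff by (auto simp: isometric_def)
  have "V (op_poly p T h) = orthogonal_projection (range V) (op_poly p U (V h))" for p h
  proof (rule orthogonal_projection_eqI[symmetric])
    show "a - b \<in> range V" if "a \<in> range V" "b \<in> range V" for a b
      using that by (auto simp flip: Vdiff)
    show "cinner (op_poly p U (V h) - V (op_poly p T h)) m = 0" if "m \<in> range V" for m
      using that V by (auto simp: cinner_diff_left weak isometric_def)
  qed simp
  then show ?thesis
    using V U by (simp add: unitary_dilation_def)
qed

text \<open>
  The vector \<open>p(T) h\<close> corresponds to a projection of \<open>p(U) V h\<close>, which can only shorten it.
\<close>

lemma von_neumann_of_dilation:
  fixes T :: "'d::finite \<Rightarrow> 'h::complex_inner \<Rightarrow> 'h" and V :: "'h \<Rightarrow> 'k::complex_inner"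
  assumes V: "isometric V" and U: "\<And>j. isometric (U j)" "commuting U"
    and weak: "\<And>p h k. cinner (op_poly p U (V h)) (V k) = cinner (op_poly p T h) k"
  shows "onorm (op_poly p T) \<le> (SUP z\<in>{z. \<forall>j. cmod (z j) \<le> 1}. cmod (eval_poly p z))" (is "_ \<le> ?S")
proof (rule onorm_bound)
  have "0 \<le> cmod (eval_poly p (\<lambda>_. 0))" by simp
  also have "\<dots> \<le> ?S" by (rule cSUP_upper[OF _ eval_poly_bounded]) simp
  finally show "0 \<le> ?S" .
  fix h
  let ?y = "op_poly p T h"
  have "norm ?y * norm ?y = Re (cinner (op_poly p U (V h)) (V ?y))"
    by (simp add: weak cinner_self power2_eq_square)
  also have "\<dots> \<le> norm (op_poly p U (V h)) * norm ?y"
    using Re_cinner_le[of "op_poly p U (V h)" "V ?y"] by (simp add: isometric_norm[OF V])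
  finally have "norm ?y \<le> norm (op_poly p U (V h))"
    by (cases "?y = 0") simp_all
  also have "\<dots> \<le> ?S * norm h"
    using von_neumann_commuting_isometries[OF U(2,1), of p "V h"] by (simp add: isometric_norm[OF V])
  finally show "norm ?y \<le> ?S * norm h" .
qed

lemma weighted_shift_commuting:
  assumes "weighted_shift e w T"
  shows "commuting T"
  unfolding commuting_def
proof (intro allI ext)
  fix j k x
  have T: "clinear (T j)" "bounded_linear (T j)" for j
    using assms by (auto simp: weighted_shift_def bounded_operator_def)
  have Te: "T j (e I) = w I j *\<^sub>R e (I + Poly_Mapping.single j 1)" for I j
    using assms by (simp add: weighted_shift_def)
  have w: "w I j * w (I + Poly_Mapping.single j 1) k = w I k * w (I + Poly_Mapping.single k 1) j" for I j k
    using assms by (simp add: weighted_shift_def)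
  have e: "orthonormal_basis e"
    using assms by (simp add: weighted_shift_def)
  have "T j (T k x) = T k (T j x)"
  proof (rule orthonormal_basis_density[OF e, where P = "\<lambda>x. T j (T k x) = T k (T j x)"])
    show "closed {x. T j (T k x) = T k (T j x)}"
      by (intro closed_Collect_eq linear_continuous_on bounded_linear_compose[OF T(2) T(2)])
    show "complex_vector.subspace {x. T j (T k x) = T k (T j x)}"
      using T(1) by (auto simp: complex_vector.subspace_def clinear_iff clinear_zero)
    show "T j (T k (e I)) = T k (T j (e I))" for I
      using w[of I k j] by (simp add: Te clinear_scaleR[OF T(1)] add_ac)
  qed
  then show "(T j \<circ> T k) x = (T k \<circ> T j) x" by simp
qed

text \<open>
  Since \<open>T\<^sup>I e\<^sub>0\<close> is a positive multiple of \<open>e\<^sub>I\<close>, its norm \<open>\<beta> I\<close> is the product of the weights along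
  any path from \<open>0\<close> to \<open>I\<close>; taking the norm of an operator monomial avoids choosing a path.
\<close>

lemma weighted_shift_moments:
  assumes T: "weighted_shift e w T" "\<And>j. onorm (T j) \<le> 1"
  shows "\<exists>\<beta>. (\<forall>I. 0 < \<beta> I \<and> \<beta> I \<le> 1) \<and> (\<forall>I K. \<beta> (I + K) \<le> \<beta> I) \<and>
    (\<forall>I K. op_monomial T K (e I) = (\<beta> (I + K) / \<beta> I) *\<^sub>R e (I + K))"
proof -
  define \<beta> where "\<beta> I = norm (op_monomial T I (e 0))" for I
  have comm: "commuting T" by (rule weighted_shift_commuting[OF T(1)])
  have monomial_step: "op_monomial T (I + Poly_Mapping.single j 1) x = T j (op_monomial T I x)" for I j x
    by (simp only: op_monomial_add_single[OF comm] o_apply)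
  have lin: "clinear (T j)" "bounded_linear (T j)" for j
    using T(1) by (auto simp: weighted_shift_def bounded_operator_def)
  have Te: "T j (e I) = w I j *\<^sub>R e (I + Poly_Mapping.single j 1)" for I j
    using T(1) by (simp add: weighted_shift_def)
  have w: "0 < w I j" for I j
    using T(1) by (simp add: weighted_shift_def)
  have ne: "norm (e I) = 1" for I
    using T(1) by (simp add: weighted_shift_def orthonormal_basis_def norm_eq_sqrt_inner inner_eq_Re_cinner)
  have w1: "w I j \<le> 1" for I j
  proof -
    have "w I j = norm (T j (e I))" using w[of I j] by (simp add: Te ne)
    also have "\<dots> \<le> onorm (T j)" using onorm[OF lin(2), of j "e I"] by (simp add: ne)
    finally show ?thesis using T(2)[of j] by linarith
  qed
  have ex: "\<exists>r>0. op_monomial T I (e 0) = r *\<^sub>R e I" for I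
  proof (induction I rule: multi_index_induct)
    case zero
    show ?case by (rule exI[of _ 1]) (simp add: op_monomial_zero)
  next
    case (add_single I j)
    then obtain r where "r > 0" "op_monomial T I (e 0) = r *\<^sub>R e I" by blast
    then show ?case
      using w[of I j] by (intro exI[of _ "r * w I j"]) (simp add: monomial_step clinear_scaleR[OF lin(1)] Te del: One_nat_def)
  qed
  have \<beta>: "op_monomial T I (e 0) = \<beta> I *\<^sub>R e I" and pos: "0 < \<beta> I" for I
  proof -
    obtain r where r: "r > 0" "op_monomial T I (e 0) = r *\<^sub>R e I" using ex[of I] by blast
    then have "\<beta> I = r" by (simp add: \<beta>_def ne)
    with r show "op_monomial T I (e 0) = \<beta> I *\<^sub>R e I" "0 < \<beta> I" by simp_all
  qed
  have step: "\<beta> (I + Poly_Mapping.single j 1) = \<beta> I * w I j" for I j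
  proof -
    have "\<beta> (I + Poly_Mapping.single j 1) = norm (T j (op_monomial T I (e 0)))"
      by (simp only: \<beta>_def monomial_step)
    then show ?thesis
      using pos[of I] w[of I j] by (simp add: \<beta> clinear_scaleR[OF lin(1)] Te ne)
  qed
  have anti: "\<beta> (I + K) \<le> \<beta> I" for I K
  proof (induction K rule: multi_index_induct)
    case (add_single K j)
    have "\<beta> (I + K) * w (I + K) j \<le> \<beta> (I + K)"
      using pos[of "I + K"] w1 by (intro mult_left_le) auto
    then show ?case using add_single by (simp only: step add.assoc[symmetric])
  qed simp
  have zero: "\<beta> 0 = 1" by (simp add: \<beta>_def op_monomial_zero ne)
  have "op_monomial T K (e I) = (\<beta> (I + K) / \<beta> I) *\<^sub>R e (I + K)" for I K
  proof (induction K rule: multi_index_induct)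
    case zero
    show ?case using pos[of I] by (simp add: op_monomial_zero)
  next
    case (add_single K j)
    show ?case
      by (simp only: monomial_step add_single.IH clinear_scaleR[OF lin(1)] Te)
         (simp only: add.assoc[symmetric] step, simp)
  qed
  moreover have "\<beta> I \<le> 1" for I
    using anti[of 0 I] zero by simp
  ultimately have "(\<forall>I. 0 < \<beta> I \<and> \<beta> I \<le> 1) \<and> (\<forall>I K. \<beta> (I + K) \<le> \<beta> I) \<and>
    (\<forall>I K. op_monomial T K (e I) = (\<beta> (I + K) / \<beta> I) *\<^sub>R e (I + K))"
    using pos anti by (intro conjI allI)
  then show ?thesis by - (rule exI[of _ \<beta>])
qed

text \<open>
  Brownian motion at time \<open>(\<beta> i)\<^sup>2\<close>, normalised to a unit vector:
  \<open>min (\<beta> i\<^sup>2) (\<beta> j\<^sup>2) / (\<beta> i \<beta> j) = \<beta> j / \<beta> i\<close> if \<open>\<beta> j \<le> \<beta> i\<close>.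
\<close>

lemma ratio_kernel_vectors:
  fixes \<beta> :: "'i::countable \<Rightarrow> real"
  assumes \<beta>: "\<And>i. 0 < \<beta> i" "\<And>i. \<beta> i \<le> 1"
  shows "\<exists>v :: 'i \<Rightarrow> nat ell2. \<forall>i j. \<beta> j \<le> \<beta> i \<longrightarrow> cinner (v i) (v j) = of_real (\<beta> j / \<beta> i)"
proof -
  define \<delta> :: "nat \<Rightarrow> nat ell2" where "\<delta> n = Abs_ell2 (\<lambda>i. if i = n then 1 else 0)" for n
  have nth: "ell2_nth (\<delta> n) i = (if i = n then 1 else 0)" for n i
  proof -
    have "(\<lambda>i. (cmod (if i = n then 1 else 0))\<^sup>2) summable_on {n}" by simp
    then have "(\<lambda>i. (cmod (if i = n then 1 else 0))\<^sup>2) summable_on UNIV"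
      by (rule summable_on_cong_neutral[THEN iffD1, rotated -1]) auto
    then show ?thesis by (simp add: \<delta>_def Abs_ell2_inverse)
  qed
  have \<delta>: "cinner (\<delta> m) (\<delta> n) = (if m = n then 1 else 0)" for m n
  proof -
    have "infsum (\<lambda>i. ell2_nth (\<delta> m) i * cnj (ell2_nth (\<delta> n) i)) UNIV
        = infsum (\<lambda>i. ell2_nth (\<delta> m) i * cnj (ell2_nth (\<delta> n) i)) {m}"
      by (rule infsum_cong_neutral) (auto simp: nth)
    then show ?thesis by (simp add: cinner_ell2_def nth)
  qed
  define t :: "nat \<Rightarrow> real" where "t n = (\<beta> (from_nat n))\<^sup>2" for n
  have t: "0 \<le> t n" "t n \<le> 1" for n
    using \<beta>[of "from_nat n"] by (simp_all add: t_def power_le_one)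
  obtain u :: "nat \<Rightarrow> nat ell2" where u: "\<forall>m n. cinner (u m) (u n) = of_real (min (t m) (t n))"
    using brownian_vectors[of t \<delta>, OF t \<delta>] ..
  define v where "v i = inverse (\<beta> i) *\<^sub>R u (to_nat i)" for i
  have "cinner (v i) (v j) = of_real (\<beta> j / \<beta> i)" if "\<beta> j \<le> \<beta> i" for i j
  proof -
    have "(\<beta> j)\<^sup>2 \<le> (\<beta> i)\<^sup>2" using that \<beta>(1)[of j] by (intro power_mono) auto
    then have "cinner (v i) (v j) = of_real (inverse (\<beta> i) * (inverse (\<beta> j) * (\<beta> j)\<^sup>2))"
      by (simp add: v_def cinner_scaleR_left cinner_scaleR_right u[rule_format] t_def min_absorb2)
    also have "inverse (\<beta> j) * (\<beta> j)\<^sup>2 = \<beta> j"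
      using \<beta>(1)[of j] by (simp add: power2_eq_square flip: mult.assoc)
    also have "inverse (\<beta> i) * \<beta> j = \<beta> j / \<beta> i"
      by (simp add: divide_inverse)
    finally show ?thesis .
  qed
  then show ?thesis by - (rule exI[of _ v], simp)
qed

text \<open>
  Under \<open>\<iota>\<close>, the space \<open>\<ell>\<^sup>2('n) \<otimes> \<ell>\<^sup>2(\<int>\<^sup>d)\<close> becomes a part of \<open>\<ell>\<^sup>2('b)\<close>, and pushing along
  \<open>\<lambda>n. \<iota> (n, a)\<close> is \<open>x \<mapsto> x \<otimes> \<delta>\<^sub>a\<close>.  The unitaries translate \<open>a\<close> and fix all coordinates outside the range
  of \<open>\<iota>\<close>.
\<close>

lemma lattice_shift_unitaries:
  fixes \<iota> :: "'n \<times> ('d::finite \<Rightarrow> int) \<Rightarrow> 'b"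
  assumes \<iota>: "inj \<iota>"
  shows "\<exists>U :: 'd \<Rightarrow> 'b ell2 \<Rightarrow> 'b ell2. (\<forall>j. unitary (U j)) \<and> commuting U \<and>
    (\<forall>K a x. op_monomial U K (ell2_push (\<lambda>n. \<iota> (n, a)) x)
        = ell2_push (\<lambda>n. \<iota> (n, \<lambda>j. a j + int (Poly_Mapping.lookup K j))) x)"
proof -
  define s :: "'d \<Rightarrow> 'n \<times> ('d \<Rightarrow> int) \<Rightarrow> 'n \<times> ('d \<Rightarrow> int)" where
    "s j = (\<lambda>(n, a). (n, a(j := a j + 1)))" for j
  define U where "U j = ell2_push (transport \<iota> (s j))" for j
  have bij_s: "bij (s j)" for j
    by (rule o_bij[where g = "\<lambda>(n, a). (n, a(j := a j - 1))"]) (auto simp: s_def fun_eq_iff)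
  then have bij: "bij (transport \<iota> (s j))" for j
    by (rule transport_bij[OF \<iota>])
  have "s j \<circ> s k = s k \<circ> s j" for j k
    by (auto simp: s_def fun_eq_iff)
  then have "U j (U k x) = U k (U j x)" for j k x
    unfolding U_def ell2_push_comp[OF bij_is_inj[OF bij] bij_is_inj[OF bij]] transport_comp[OF \<iota>] by simp
  then have comm: "commuting U"
    by (simp add: commuting_def fun_eq_iff)
  have slot: "inj (\<lambda>n. \<iota> (n, a))" for a
    using \<iota> by (auto intro!: injI dest: injD)
  have step: "U j (ell2_push (\<lambda>n. \<iota> (n, a)) x) = ell2_push (\<lambda>n. \<iota> (n, a(j := a j + 1))) x" for j a x
    unfolding U_def ell2_push_comp[OF bij_is_inj[OF bij] slot] o_def transport_image[OF \<iota>]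
    by (simp add: s_def)
  have "op_monomial U K (ell2_push (\<lambda>n. \<iota> (n, a)) x)
        = ell2_push (\<lambda>n. \<iota> (n, \<lambda>j. a j + int (Poly_Mapping.lookup K j))) x" for K a x
  proof (induction K rule: multi_index_induct)
    case (add_single K k)
    have "(\<lambda>j. a j + int (Poly_Mapping.lookup (K + Poly_Mapping.single k 1) j))
        = (\<lambda>j. a j + int (Poly_Mapping.lookup K j))(k := a k + int (Poly_Mapping.lookup K k) + 1)"
      by (auto simp: fun_eq_iff lookup_add lookup_single when_def)
    then show ?case
      by (simp only: op_monomial_add_single[OF comm] o_apply add_single.IH step)
  qed (simp add: op_monomial_zero)
  moreover have "unitary (U j)" for j
    unfolding U_def by (rule ell2_push_unitary[OF bij])
  ultimately show ?thesis using comm by - (rule exI[of _ U], simp)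
qed

text \<open>
  The isometry \<open>e\<^sub>I \<mapsto> v\<^sub>I \<otimes> \<delta>\<^sub>I\<close> together with the lattice shifts.
\<close>

theorem weighted_shift_dilation:
  fixes e :: "'d::finite multi_index \<Rightarrow> 'h::chilbert_space" and T :: "'d \<Rightarrow> 'h \<Rightarrow> 'h"
  assumes T: "weighted_shift e w T" "\<And>j. onorm (T j) \<le> 1"
  shows "\<exists>(V :: 'h \<Rightarrow> 'h ell2) U. isometric V \<and> (\<forall>j. unitary (U j)) \<and> commuting U \<and>
    (\<forall>p h k. cinner (op_poly p U (V h)) (V k) = cinner (op_poly p T h) k)"
proof -
  have e: "orthonormal_basis e" and bdd: "\<And>j. bounded_operator (T j)"
    using T(1) by (auto simp: weighted_shift_def)
  have ee: "cinner (e I) (e J) = (if I = J then 1 else 0)" for I J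
    using e by (simp add: orthonormal_basis_def)
  obtain \<beta> where "(\<forall>I. 0 < \<beta> I \<and> \<beta> I \<le> 1) \<and> (\<forall>I K. \<beta> (I + K) \<le> \<beta> I) \<and>
    (\<forall>I K. op_monomial T K (e I) = (\<beta> (I + K) / \<beta> I) *\<^sub>R e (I + K))"
    using weighted_shift_moments[OF T] ..
  then have \<beta>: "\<And>I. 0 < \<beta> I" "\<And>I. \<beta> I \<le> 1" "\<And>I K. \<beta> (I + K) \<le> \<beta> I"
    and moments: "\<And>I K. op_monomial T K (e I) = (\<beta> (I + K) / \<beta> I) *\<^sub>R e (I + K)"
    by simp_all
  \<comment> \<open>\<open>\<gamma>\<close> is \<open>\<beta>\<close> read on functions, whose type is an instance of \<open>countable\<close>.\<close>
  define \<gamma> :: "('d \<Rightarrow> nat) \<Rightarrow> real" where "\<gamma> f = \<beta> (Abs_poly_mapping f)" for f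
  have \<gamma>: "\<gamma> (Poly_Mapping.lookup I) = \<beta> I" for I
    by (simp add: \<gamma>_def lookup_inverse)
  have "\<exists>v :: ('d \<Rightarrow> nat) \<Rightarrow> nat ell2. \<forall>f g. \<gamma> g \<le> \<gamma> f \<longrightarrow> cinner (v f) (v g) = of_real (\<gamma> g / \<gamma> f)"
    by (rule ratio_kernel_vectors) (simp_all add: \<gamma>_def \<beta>)
  then obtain v :: "('d \<Rightarrow> nat) \<Rightarrow> nat ell2"
    where v: "\<forall>f g. \<gamma> g \<le> \<gamma> f \<longrightarrow> cinner (v f) (v g) = of_real (\<gamma> g / \<gamma> f)" ..
  \<comment> \<open>The distinct vectors \<open>e (k \<epsilon>\<^sub>j)\<close>, for one fixed \<open>j\<close>, supply countably many elements of the
    space as indices.\<close>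
  define \<iota> :: "nat \<times> ('d \<Rightarrow> int) \<Rightarrow> 'h" where "\<iota> p = e (Poly_Mapping.single undefined (to_nat p))" for p
  have "inj \<iota>"
  proof (rule injI)
    fix p q assume "\<iota> p = \<iota> q"
    then have "Poly_Mapping.single undefined (to_nat p) = (Poly_Mapping.single undefined (to_nat q) :: 'd multi_index)"
      unfolding \<iota>_def by (metis ee zero_neq_one)
    then have "to_nat p = to_nat q" by (metis lookup_single_eq)
    then show "p = q" by simp
  qed
  obtain U :: "'d \<Rightarrow> 'h ell2 \<Rightarrow> 'h ell2" where "(\<forall>j. unitary (U j)) \<and> commuting U \<and>
      (\<forall>K a x. op_monomial U K (ell2_push (\<lambda>n. \<iota> (n, a)) x)
        = ell2_push (\<lambda>n. \<iota> (n, \<lambda>j. a j + int (Poly_Mapping.lookup K j))) x)"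
    using lattice_shift_unitaries[OF \<open>inj \<iota>\<close>] ..
  then have U: "\<And>j. unitary (U j)" "commuting U"
    and shift: "\<And>K a x. op_monomial U K (ell2_push (\<lambda>n. \<iota> (n, a)) x)
        = ell2_push (\<lambda>n. \<iota> (n, \<lambda>j. a j + int (Poly_Mapping.lookup K j))) x"
    by simp_all
  define slot where "slot I = (\<lambda>n. \<iota> (n, \<lambda>j. int (Poly_Mapping.lookup I j)))" for I
  have inj_slot: "inj (slot I)" for I
    by (rule injI) (simp add: slot_def inj_eq[OF \<open>inj \<iota>\<close>])
  have disjoint: "range (slot I) \<inter> range (slot J) = {}" if "I \<noteq> J" for I J
  proof -
    have "(\<lambda>j. int (Poly_Mapping.lookup I j)) \<noteq> (\<lambda>j. int (Poly_Mapping.lookup J j))"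
      using that by (simp add: poly_mapping_eq_iff fun_eq_iff)
    then show ?thesis
      by (auto simp: slot_def inj_eq[OF \<open>inj \<iota>\<close>])
  qed
  define b where "b I = ell2_push (slot I) (v (Poly_Mapping.lookup I))" for I
  have bb: "cinner (ell2_push (slot (I + K)) (v (Poly_Mapping.lookup I))) (b J)
      = (if I + K = J then of_real (\<beta> J / \<beta> I) else 0)" for I K J
  proof (cases "I + K = J")
    case True
    have "cinner (ell2_push (slot J) (v (Poly_Mapping.lookup I))) (b J)
        = cinner (v (Poly_Mapping.lookup I)) (v (Poly_Mapping.lookup J))"
      using ell2_push_isometric[OF inj_slot[of J]] by (simp add: isometric_def b_def)
    also have "\<dots> = of_real (\<beta> J / \<beta> I)"
      using v[rule_format, of "Poly_Mapping.lookup J" "Poly_Mapping.lookup I"] \<beta>(3)[of I K] True by (simp add: \<gamma>)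
    finally show ?thesis using True by simp
  next
    case False
    then show ?thesis
      unfolding b_def using cinner_ell2_push_disjoint[OF inj_slot inj_slot disjoint] by simp
  qed
  have "cinner (b I) (b J) = (if I = J then 1 else 0)" for I J
    using bb[of I 0 J] \<beta>(1)[of J] by (auto simp: b_def[of I])
  then have "\<exists>V. isometric V \<and> (\<forall>I. V (e I) = b I)"
    by (rule isometric_extension[OF e])
  then obtain V where "isometric V \<and> (\<forall>I. V (e I) = b I)" ..
  then have V: "isometric V" "\<And>I. V (e I) = b I" by simp_all
  have "cinner (op_poly p U (V h)) (V k) = cinner (op_poly p T h) k" for p h k
  proof (rule weak_dilation_from_basis[OF e weighted_shift_commuting[OF T(1)] bdd V(1)])
    show "isometric (U j)" for j using U(1) by (simp add: unitary_def)
    show "commuting U" by fact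
    fix K I J
    have "op_monomial U K (b I) = ell2_push (slot (I + K)) (v (Poly_Mapping.lookup I))"
      by (simp add: b_def slot_def shift lookup_add)
    then show "cinner (op_monomial U K (V (e I))) (V (e J)) = cinner (op_monomial T K (e I)) (e J)"
      by (simp add: V(2) bb moments cinner_scaleR_left ee)
  qed
  with V(1) U show ?thesis by - (rule exI[of _ V], rule exI[of _ U], simp)
qed

theorem theorem1p1:
  fixes e :: "'d::finite multi_index \<Rightarrow> 'h::chilbert_space"
    and w :: "'d multi_index \<Rightarrow> 'd \<Rightarrow> real"
    and T :: "'d \<Rightarrow> 'h \<Rightarrow> 'h"
  assumes "weighted_shift e w T"
    and "\<And>j. onorm (T j) \<le> 1"
  shows "dilates_to_commuting_unitaries T \<and>
    (\<forall>p :: 'd polynomial.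
       onorm (op_poly p T) \<le> (SUP z\<in>{z. \<forall>j. cmod (z j) \<le> 1}. cmod (eval_poly p z)))"
proof (intro conjI allI)
  obtain V :: "'h \<Rightarrow> 'h ell2" and U where "isometric V \<and> (\<forall>j. unitary (U j)) \<and> commuting U \<and>
    (\<forall>p h k. cinner (op_poly p U (V h)) (V k) = cinner (op_poly p T h) k)"
    using weighted_shift_dilation[OF assms] by (elim exE)
  then have dil: "isometric V" "\<And>j. unitary (U j)" "commuting U"
    "\<And>p h k. cinner (op_poly p U (V h)) (V k) = cinner (op_poly p T h) k"
    by simp_all
  have "unitary_dilation T V U"
    using dil by (rule unitary_dilationI)
  then show "dilates_to_commuting_unitaries T"
    using weighted_shift_commuting[OF assms(1)] by (auto simp: dilates_to_commuting_unitaries_def)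
  have "isometric (U j)" for j
    using dil(2) by (simp add: unitary_def)
  with dil(1) show "onorm (op_poly p T) \<le> (SUP z\<in>{z. \<forall>j. cmod (z j) \<le> 1}. cmod (eval_poly p z))" for p
    using dil(3,4) by (rule von_neumann_of_dilation)
qed

end
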